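(* Let $\Theta$ be a finite simple oriented graph whose simple oriented cycles are $C_1,\ldots,C_k$ for some $k\geq 1$, and assume that $\Theta$ does not contain two different cycles connected by an oriented path (of length $\geq 0$). Then for any non-cycle vertex $x$ that is connected by an oriented path with a cycle, either all oriented paths between $x$ and the cycles are directed from $x$ into the cycles, or all of them begin at the cycles. For $j=1,\ldots,k$ let $\mathcal{A}_j$ be the set of vertices of $\Theta$ not lying on $C_j$ that are connected by an edge (in either direction) with some vertex of $C_j$. For $x\in\mathcal{A}_j$ let $k_x$ be the number of oriented paths of length $\geq 0$ in $\Theta$ that start at $x$ if all paths between $C_j$ and $x$ start at cycle vertices, and the number of oriented paths of length $\geq 0$ in $\Theta$ that end at $x$ otherwise. Then $$\operatorname{GKdim} A_{\Theta}=\sum_{j=1}^{k}\Big(\sum_{x\in\mathcal{A}_j}k_x+1\Big),$$ where the inner term $\sum_{x\in\mathcal{A}_j}k_x+1$ equals $1$ if $\mathcal{A}_j=\emptyset$. Moreover, if $\Theta$ contains no oriented cycle, then $\operatorname{GKdim}A_\Theta=0$.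
   Context: For a finite simple oriented graph $\Theta$ with vertices $x_1,\ldots,x_n$, the Hecke--Kiselman monoid $\mathrm{HK}_\Theta$ is the monoid generated by $x_1,\ldots,x_n$ subject to: $x_i^2=x_i$ for all $i$; $x_ix_j=x_jx_i$ if $x_i,x_j$ are not connected by an edge; $x_ix_jx_i=x_jx_ix_j=x_ix_j$ if there is an arrow $x_i\to x_j$. $A_\Theta$ denotes the monoid algebra $k[\mathrm{HK}_\Theta]$ over a field $k$, and $\operatorname{GKdim}$ is the Gelfand--Kirillov dimension. A path of length $0$ at a vertex $x$ counts as exactly one path starting (and ending) at $x$. Cycles are simple oriented cycles (of length $\geq 3$). *)

theory Defs
  imports "HOL-Analysis.Analysis" "HOL-Library.Liminf_Limsup" "HOL-Library.Function_Algebras"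
begin

definition simple_oriented_graph :: "'v set \<Rightarrow> ('v \<Rightarrow> 'v \<Rightarrow> bool) \<Rightarrow> bool" where
  "simple_oriented_graph V E \<longleftrightarrow> finite V
     \<and> (\<forall>a b. E a b \<longrightarrow> a \<in> V \<and> b \<in> V)
     \<and> (\<forall>a. \<not> E a a)
     \<and> (\<forall>a b. E a b \<longrightarrow> \<not> E b a)"

definition opath :: "'v set \<Rightarrow> ('v \<Rightarrow> 'v \<Rightarrow> bool) \<Rightarrow> 'v list \<Rightarrow> bool" where
  "opath V E p \<longleftrightarrow> p \<noteq> [] \<and> set p \<subseteq> V \<and> distinct p
     \<and> (\<forall>i. Suc i < length p \<longrightarrow> E (p ! i) (p ! Suc i))"

text \<open>Simple oriented cycles of length >= 3, given by a list of distinct vertices;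
  the cycle itself is identified with its set of arrows (so rotations of the
  list give the same cycle).\<close>

definition cycle_list :: "'v set \<Rightarrow> ('v \<Rightarrow> 'v \<Rightarrow> bool) \<Rightarrow> 'v list \<Rightarrow> bool" where
  "cycle_list V E cs \<longleftrightarrow> length cs \<ge> 3 \<and> set cs \<subseteq> V \<and> distinct cs
     \<and> (\<forall>i < length cs. E (cs ! i) (cs ! ((Suc i) mod length cs)))"

definition cycle_arrows :: "'v list \<Rightarrow> ('v \<times> 'v) set" where
  "cycle_arrows cs = {(cs ! i, cs ! ((Suc i) mod length cs)) | i. i < length cs}"

definition cycles :: "'v set \<Rightarrow> ('v \<Rightarrow> 'v \<Rightarrow> bool) \<Rightarrow> ('v \<times> 'v) set set" where
  "cycles V E = {cycle_arrows cs | cs. cycle_list V E cs}"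

definition cverts :: "('v \<times> 'v) set \<Rightarrow> 'v set" where
  "cverts C = fst ` C"

definition cycle_vertices :: "'v set \<Rightarrow> ('v \<Rightarrow> 'v \<Rightarrow> bool) \<Rightarrow> 'v set" where
  "cycle_vertices V E = (\<Union>C\<in>cycles V E. cverts C)"

definition path_between :: "'v set \<Rightarrow> ('v \<Rightarrow> 'v \<Rightarrow> bool) \<Rightarrow> 'v set \<Rightarrow> 'v \<Rightarrow> 'v list \<Rightarrow> bool" where
  "path_between V E S x p \<longleftrightarrow> opath V E p
     \<and> ((hd p \<in> S \<and> last p = x) \<or> (hd p = x \<and> last p \<in> S))"

definition adj_set :: "'v set \<Rightarrow> ('v \<Rightarrow> 'v \<Rightarrow> bool) \<Rightarrow> ('v \<times> 'v) set \<Rightarrow> 'v set" where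
  "adj_set V E C = {y \<in> V. y \<notin> cverts C \<and> (\<exists>z \<in> cverts C. E y z \<or> E z y)}"

definition kx :: "'v set \<Rightarrow> ('v \<Rightarrow> 'v \<Rightarrow> bool) \<Rightarrow> ('v \<times> 'v) set \<Rightarrow> 'v \<Rightarrow> nat" where
  "kx V E C x =
     (if (\<forall>p. path_between V E (cverts C) x p \<longrightarrow> hd p \<in> cverts C)
      then card {p. opath V E p \<and> hd p = x}
      else card {p. opath V E p \<and> last p = x})"

inductive hk_step :: "'v set \<Rightarrow> ('v \<Rightarrow> 'v \<Rightarrow> bool) \<Rightarrow> 'v list \<Rightarrow> 'v list \<Rightarrow> bool"
  for V E where
  idem: "a \<in> V \<Longrightarrow> hk_step V E (u @ [a, a] @ w) (u @ [a] @ w)"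
| comm: "a \<in> V \<Longrightarrow> b \<in> V \<Longrightarrow> \<not> E a b \<Longrightarrow> \<not> E b a \<Longrightarrow>
           hk_step V E (u @ [a, b] @ w) (u @ [b, a] @ w)"
| arr1: "E a b \<Longrightarrow> hk_step V E (u @ [a, b, a] @ w) (u @ [a, b] @ w)"
| arr2: "E a b \<Longrightarrow> hk_step V E (u @ [b, a, b] @ w) (u @ [a, b] @ w)"

definition hk_eq :: "'v set \<Rightarrow> ('v \<Rightarrow> 'v \<Rightarrow> bool) \<Rightarrow> 'v list \<Rightarrow> 'v list \<Rightarrow> bool" where
  "hk_eq V E = equivclp (hk_step V E)"

definition hk_class :: "'v set \<Rightarrow> ('v \<Rightarrow> 'v \<Rightarrow> bool) \<Rightarrow> 'v list \<Rightarrow> 'v list set" where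
  "hk_class V E w = {u. set u \<subseteq> V \<and> hk_eq V E u w}"

definition hk_elems :: "'v set \<Rightarrow> ('v \<Rightarrow> 'v \<Rightarrow> bool) \<Rightarrow> 'v list set set" where
  "hk_elems V E = {hk_class V E w | w. set w \<subseteq> V}"

definition hk_mul :: "'v set \<Rightarrow> ('v \<Rightarrow> 'v \<Rightarrow> bool) \<Rightarrow> 'v list set \<Rightarrow> 'v list set \<Rightarrow> 'v list set" where
  "hk_mul V E a b = hk_class V E ((SOME u. u \<in> a) @ (SOME w. w \<in> b))"

definition hk_algebra :: "'v set \<Rightarrow> ('v \<Rightarrow> 'v \<Rightarrow> bool) \<Rightarrow> ('v list set \<Rightarrow> 'k::field) set" where
  "hk_algebra V E = {f. finite {c. f c \<noteq> 0} \<and> {c. f c \<noteq> 0} \<subseteq> hk_elems V E}"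

definition alg_mult :: "'v set \<Rightarrow> ('v \<Rightarrow> 'v \<Rightarrow> bool) \<Rightarrow> ('v list set \<Rightarrow> 'k::field)
     \<Rightarrow> ('v list set \<Rightarrow> 'k) \<Rightarrow> ('v list set \<Rightarrow> 'k)" where
  "alg_mult V E f g = (\<lambda>c. \<Sum>(a, b) \<in> {(a, b). f a \<noteq> 0 \<and> g b \<noteq> 0 \<and> hk_mul V E a b = c}.
                                 f a * g b)"

definition alg_one :: "'v set \<Rightarrow> ('v \<Rightarrow> 'v \<Rightarrow> bool) \<Rightarrow> ('v list set \<Rightarrow> 'k::field)" where
  "alg_one V E = (\<lambda>c. if c = hk_class V E [] then 1 else 0)"

abbreviation fscale :: "'k::field \<Rightarrow> ('a \<Rightarrow> 'k) \<Rightarrow> ('a \<Rightarrow> 'k)" where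
  "fscale \<equiv> (\<lambda>c f x. c * f x)"

abbreviation fspan :: "('a \<Rightarrow> 'k::field) set \<Rightarrow> ('a \<Rightarrow> 'k) set" where
  "fspan \<equiv> module.span fscale"

abbreviation fdim :: "('a \<Rightarrow> 'k::field) set \<Rightarrow> nat" where
  "fdim \<equiv> vector_space.dim fscale"

definition sub_mult :: "'v set \<Rightarrow> ('v \<Rightarrow> 'v \<Rightarrow> bool) \<Rightarrow> ('v list set \<Rightarrow> 'k::field) set
     \<Rightarrow> ('v list set \<Rightarrow> 'k) set \<Rightarrow> ('v list set \<Rightarrow> 'k) set" where
  "sub_mult V E W1 W2 = fspan {alg_mult V E f g | f g. f \<in> W1 \<and> g \<in> W2}"

fun sub_pow :: "'v set \<Rightarrow> ('v \<Rightarrow> 'v \<Rightarrow> bool) \<Rightarrow> ('v list set \<Rightarrow> 'k::field) set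
     \<Rightarrow> nat \<Rightarrow> ('v list set \<Rightarrow> 'k) set" where
  "sub_pow V E W 0 = fspan {alg_one V E}"
| "sub_pow V E W (Suc n) = sub_mult V E (sub_pow V E W n) W"

definition sub_filt :: "'v set \<Rightarrow> ('v \<Rightarrow> 'v \<Rightarrow> bool) \<Rightarrow> ('v list set \<Rightarrow> 'k::field) set
     \<Rightarrow> nat \<Rightarrow> ('v list set \<Rightarrow> 'k) set" where
  "sub_filt V E W n = fspan (\<Union>i\<le>n. sub_pow V E W i)"

definition GKdim_HK :: "'k::field itself \<Rightarrow> 'v set \<Rightarrow> ('v \<Rightarrow> 'v \<Rightarrow> bool) \<Rightarrow> ereal" where
  "GKdim_HK _ V E =
     (SUP B \<in> {B :: ('v list set \<Rightarrow> 'k) set. finite B \<and> B \<subseteq> hk_algebra V E}.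
        limsup (\<lambda>n. ereal (ln (real (fdim (sub_filt V E (fspan B) n))) / ln (real n))))"

end

theory Submission
  imports Defs "HOL-Real_Asymp.Real_Asymp"
begin

text \<open>The dimension is the growth exponent of the monoid, computed from words.

  Upper bound: in a shortest word for an element, any two consecutive occurrences of a letter \<open>x\<close>
  enclose an in-neighbour and an out-neighbour of \<open>x\<close>. So a vertex outside the cycles occurs at
  most as often as there are paths ending (or starting) at it, and between two occurrences of
  letters adjacent to a cycle the consecutive letters of that cycle alternate, which leaves one
  free parameter of linear size. Since a word is determined up to commutation by its projections
  to pairs of adjacent letters, a cycle \<open>C\<close> contributes the exponent \<open>1 + (\<Sum>x\<in>A. k\<^sub>x)\<close>, where \<open>A\<close> is
  the set of its neighbours.

  Lower bound: some word in the non-cycle letters attains all the bounds \<open>k\<^sub>x\<close>, and powers of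
  the cycles with independent exponents are inserted into it. The exponents are recovered from the
  monoid element by letting the monoid act on vertex states: the letter \<open>v\<close> recomputes the state of
  \<open>v\<close> from the states of its in-neighbours, for any choice of the update functions. Suitable ones
  count the turns around a cycle that follow the \<open>r\<close>-th occurrence of an adjacent letter.\<close>

section \<open>Words and the Hecke--Kiselman congruence\<close>

text \<open>Separation of the cycles splits the non-cycle vertices into \<open>below\<close>, closed
  under predecessors, and \<open>above\<close>, closed under successors, both without returns. On
  such a set counts are governed by a recursion: that of \<open>x\<close> is at most one plus the
  sum over its in-neighbours, and with equality this is the recursion for paths ending at
  \<open>x\<close>. In a reduced word the neighbours of a cycle \<open>C\<close> thus cut it into at
  most \<open>degree_bound C + 1\<close> segments; the extra segment is the \<open>+ 1\<close> of
  the formula. Letters of different cycles commute, so the contributions add.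

  The obstacle in the lower bound is inequivalence: differing exponents have to be detected by maps
  constant on congruence classes. An update at \<open>v\<close> may read in-neighbours only, so
  reading forwards notices neighbours with an arrow into the cycle, but not those with an arrow out
  of it. The latter are handled by reversing words, which passes to the opposite graph. Forward
  reading counts the cycle letters after a given neighbour, backward reading those before it; the
  total exponent, itself an invariant, makes the two comparable.\<close>

lemma hk_eq_refl [simp]: "hk_eq V E w w"
  by (simp add: hk_eq_def)

lemma hk_eq_sym: "hk_eq V E u w \<Longrightarrow> hk_eq V E w u"
  unfolding hk_eq_def by (rule equivclp_sym)

lemma hk_eq_trans [trans]: "hk_eq V E u v \<Longrightarrow> hk_eq V E v w \<Longrightarrow> hk_eq V E u w"
  unfolding hk_eq_def by (rule equivclp_trans)

lemma hk_eq_stepI: "hk_step V E u w \<Longrightarrow> hk_eq V E u w"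
  unfolding hk_eq_def by blast

lemma hk_eq_induct [consumes 1, case_names refl step]:
  assumes "hk_eq V E u w"
    and "P u"
    and "\<And>x y. hk_eq V E u x \<Longrightarrow> hk_step V E x y \<or> hk_step V E y x \<Longrightarrow> P x \<Longrightarrow> P y"
  shows "P w"
  using assms(1) unfolding hk_eq_def
  by (induction rule: equivclp_induct) (use assms(2,3) in \<open>auto simp: hk_eq_def\<close>)

lemma hk_step_append: "hk_step V E u w \<Longrightarrow> hk_step V E (p @ u @ q) (p @ w @ q)"
proof (induction rule: hk_step.induct)
  case (idem a u w)
  then show ?case using hk_step.idem[of a V E "p @ u" "w @ q"] by simp
next
  case (comm a b u w)
  then show ?case using hk_step.comm[of a V b E "p @ u" "w @ q"] by simp
next
  case (arr1 a b u w)
  then show ?case using hk_step.arr1[of E a b V "p @ u" "w @ q"] by simp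
next
  case (arr2 a b u w)
  then show ?case using hk_step.arr2[of E a b V "p @ u" "w @ q"] by simp
qed

lemma hk_eq_context: "hk_eq V E u w \<Longrightarrow> hk_eq V E (p @ u @ q) (p @ w @ q)"
proof (induction rule: hk_eq_induct)
  case (step x y)
  then have "hk_eq V E (p @ x @ q) (p @ y @ q)"
    using hk_eq_stepI[OF hk_step_append[of V E x y p q]]
      hk_eq_sym[OF hk_eq_stepI[OF hk_step_append[of V E y x p q]]] by blast
  with step show ?case by (blast intro: hk_eq_trans)
qed simp

lemma hk_eq_append: "hk_eq V E u u' \<Longrightarrow> hk_eq V E w w' \<Longrightarrow> hk_eq V E (u @ w) (u' @ w')"
  using hk_eq_context[of V E u u' "[]" w] hk_eq_context[of V E w w' u' "[]"]
  by (auto intro: hk_eq_trans)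

lemma hk_eq_Cons: "hk_eq V E u w \<Longrightarrow> hk_eq V E (a # u) (a # w)"
  using hk_eq_append[of V E "[a]" "[a]" u w] by simp

text \<open>Reversal passes to the opposite graph and exchanges the two arrow relations. Bounds and
  invariants on the side of out-neighbours are obtained from those for in-neighbours through this
  symmetry.\<close>

lemma hk_step_rev: "hk_step V E u w \<Longrightarrow> hk_step V (\<lambda>a b. E b a) (rev u) (rev w)"
proof (induction rule: hk_step.induct)
  case (idem a u w)
  then show ?case using hk_step.idem[of a V _ "rev w" "rev u"] by simp
next
  case (comm a b u w)
  then show ?case using hk_step.comm[of b V a "\<lambda>a b. E b a" "rev w" "rev u"] by simp
next
  case (arr1 a b u w)
  then show ?case using hk_step.arr2[of "\<lambda>a b. E b a" b a V "rev w" "rev u"] by simp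
next
  case (arr2 a b u w)
  then show ?case using hk_step.arr1[of "\<lambda>a b. E b a" b a V "rev w" "rev u"] by simp
qed

lemma hk_eq_rev: "hk_eq V E u w \<Longrightarrow> hk_eq V (\<lambda>a b. E b a) (rev u) (rev w)"
proof (induction rule: hk_eq_induct)
  case (step x y)
  then have "hk_eq V (\<lambda>a b. E b a) (rev x) (rev y)"
    using hk_eq_stepI[OF hk_step_rev[of V E x y]] hk_eq_sym[OF hk_eq_stepI[OF hk_step_rev[of V E y x]]]
    by blast
  with step show ?case by (blast intro: hk_eq_trans)
qed simp

text \<open>The last \<open>x\<close> travels left through \<open>u\<close>: it commutes with
  letters not adjacent to \<open>x\<close> and is absorbed at a letter \<open>y\<close> with
  \<open>E x y\<close>, because \<open>xyx = xy\<close>.\<close>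

lemma hk_eq_delete_right:
  assumes "x \<in> V" "set u \<subseteq> V" "\<forall>z\<in>set u. \<not> E z x"
  shows "hk_eq V E (x # u @ [x]) (x # u)"
  using assms(2,3)
proof (induction u rule: rev_induct)
  case Nil
  show ?case using hk_step.idem[of x V E "[]" "[]"] assms(1) by (auto intro: hk_eq_stepI)
next
  case (snoc y u)
  then have IH: "hk_eq V E (x # u @ [x]) (x # u)" and y: "y \<in> V" "\<not> E y x"
    by auto
  show ?case
  proof (cases "E x y")
    case True
    \<comment> \<open>The induction hypothesis is used backwards to plant an \<open>x\<close> in
      front of \<open>y\<close>, so that \<open>arr1\<close> applies, and forwards to remove it
      again.\<close>
    have "hk_eq V E ((x # u) @ [y, x]) ((x # u @ [x]) @ [y, x])"
      using hk_eq_append[OF hk_eq_sym[OF IH] hk_eq_refl] .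
    also have "(x # u @ [x]) @ [y, x] = (x # u) @ [x, y, x] @ []" by simp
    also have "hk_eq V E \<dots> ((x # u) @ [x, y] @ [])"
      by (rule hk_eq_stepI, rule hk_step.arr1, rule True)
    also have "(x # u) @ [x, y] @ [] = (x # u @ [x]) @ [y]" by simp
    also have "hk_eq V E \<dots> ((x # u) @ [y])"
      using hk_eq_append[OF IH hk_eq_refl] .
    finally show ?thesis by simp
  next
    case False
    have "hk_eq V E ((x # u) @ [y, x] @ []) ((x # u) @ [x, y] @ [])"
      by (rule hk_eq_stepI, rule hk_step.comm) (use y assms(1) False in auto)
    also have "(x # u) @ [x, y] @ [] = (x # u @ [x]) @ [y]" by simp
    also have "hk_eq V E \<dots> ((x # u) @ [y])"
      using hk_eq_append[OF IH hk_eq_refl] .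
    finally show ?thesis by simp
  qed
qed

lemma hk_eq_delete_left:
  assumes "x \<in> V" "set u \<subseteq> V" "\<forall>z\<in>set u. \<not> E x z"
  shows "hk_eq V E (x # u @ [x]) (u @ [x])"
proof -
  have "hk_eq V (\<lambda>a b. E b a) (x # rev u @ [x]) (x # rev u)"
    by (rule hk_eq_delete_right) (use assms in auto)
  from hk_eq_rev[OF this] show ?thesis by simp
qed

text \<open>Neighbours in a filtered word are letters of \<open>w\<close> with only discarded
  letters between them. This turns a condition on factors of \<open>w\<close>, such as
  \<open>reduced\<close>, into one on neighbours.\<close>

lemma filter_successivelyI:
  assumes "\<And>p a u b q. w = p @ a # u @ b # q \<Longrightarrow> P a \<Longrightarrow> P b \<Longrightarrow> \<forall>z\<in>set u. \<not> P z \<Longrightarrow> R a b"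
  shows "successively R (filter P w)"
  using assms
proof (induction w)
  case (Cons x w)
  have IH: "successively R (filter P w)"
    by (rule Cons.IH) (use Cons.prems[of "x # _"] in auto)
  show ?case
  proof (cases "P x \<and> filter P w \<noteq> []")
    case True
    then have "filter P w = hd (filter P w) # tl (filter P w)" by simp
    from this[unfolded filter_eq_Cons_iff] obtain u b q
      where w: "w = u @ b # q" "\<forall>z\<in>set u. \<not> P z" "P b" "hd (filter P w) = b"
      by blast
    have "R x b"
      by (rule Cons.prems[of "[]" x u b q]) (use w True in auto)
    with IH w(4) True show ?thesis by (simp add: successively_Cons)
  qed (use IH in \<open>auto simp: successively_Cons\<close>)
qed simp

section \<open>Two-letter projections determine a word up to commutation\<close>

lemma hk_eq_move_front:
  assumes "a \<in> V" "set p \<subseteq> V" "\<forall>b\<in>set p. \<not> E a b \<and> \<not> E b a"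
  shows "hk_eq V E (p @ [a]) (a # p)"
  using assms(2,3)
proof (induction p)
  case (Cons b p)
  then have "hk_eq V E (b # p @ [a]) (b # a # p)" by (intro hk_eq_Cons) auto
  also have "hk_eq V E (b # a # p) (a # b # p)"
    using hk_step.comm[of b V a E "[]" p] Cons.prems assms(1) by (auto intro!: hk_eq_stepI)
  finally show ?case by simp
qed simp

text \<open>The projection criterion for partially commutative words; only commutations are used.
  The first letter \<open>a\<close> of \<open>u\<close> can be brought to the front of
  \<open>w\<close>: a letter adjacent to \<open>a\<close> standing before its first occurrence in
  \<open>w\<close> would show in a common projection. Counts are compared as well, since a letter
  without edges is in no projection.\<close>

lemma hk_eq_if_same_projections:
  assumes "set u \<subseteq> V" "set w \<subseteq> V"
    and "\<And>a. count_list u a = count_list w a"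
    and "\<And>a b. E a b \<Longrightarrow> filter (\<lambda>z. z = a \<or> z = b) u = filter (\<lambda>z. z = a \<or> z = b) w"
  shows "hk_eq V E u w"
  using assms
proof (induction u arbitrary: w)
  case Nil
  then have "a \<notin> set w" for a using Nil.prems(3)[of a] by (simp add: count_list_0_iff[symmetric])
  then have "w = []" by (cases w) auto
  then show ?case by simp
next
  case (Cons a u)
  have "count_list w a \<noteq> 0" using Cons.prems(3)[of a] by simp
  then obtain p q where w: "w = p @ a # q" "a \<notin> set p"
    using split_list_first[of a w] by (metis count_notin)
  have p: "\<not> E a b \<and> \<not> E b a" if "b \<in> set p" for b
  proof (rule ccontr)
    assume "\<not> (\<not> E a b \<and> \<not> E b a)"
    then have "filter (\<lambda>z. z = a \<or> z = b) (a # u) = filter (\<lambda>z. z = a \<or> z = b) w"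
      using Cons.prems(4)[of a b] Cons.prems(4)[of b a] by (auto simp: disj_commute)
    then have "hd (filter (\<lambda>z. z = a \<or> z = b) w) = a"
      using filter.simps(2)[of "\<lambda>z. z = a \<or> z = b" a u] by (metis list.sel(1))
    moreover have "filter (\<lambda>z. z = a \<or> z = b) p \<noteq> []" using that by (auto simp: filter_empty_conv)
    then have "hd (filter (\<lambda>z. z = a \<or> z = b) p) \<in> set (filter (\<lambda>z. z = a \<or> z = b) p)"
      by (rule hd_in_set)
    then have "hd (filter (\<lambda>z. z = a \<or> z = b) p) \<noteq> a" using w(2) by auto
    ultimately show False using w \<open>filter (\<lambda>z. z = a \<or> z = b) p \<noteq> []\<close> by simp
  qed
  have move: "hk_eq V E w (a # p @ q)"
    using hk_eq_append[OF hk_eq_move_front[of a V p E] hk_eq_refl[of V E q]] Cons.prems(2) w(1) p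
    by auto
  have "hk_eq V E u (p @ q)"
  proof (rule Cons.IH)
    show "set u \<subseteq> V" "set (p @ q) \<subseteq> V" using Cons.prems(1,2) w by auto
    show "count_list u x = count_list (p @ q) x" for x
      using Cons.prems(3)[of x] w by (auto split: if_splits)
    show "filter (\<lambda>z. z = x \<or> z = y) u = filter (\<lambda>z. z = x \<or> z = y) (p @ q)" if "E x y" for x y
    proof (cases "a = x \<or> a = y")
      case True
      then have "\<forall>z\<in>set p. \<not> (z = x \<or> z = y)" using p that w(2) by blast
      then have "filter (\<lambda>z. z = x \<or> z = y) p = []" by (auto simp: filter_empty_conv)
      then show ?thesis using Cons.prems(4)[OF that] w(1) True by auto
    qed (use Cons.prems(4)[OF that] w(1) in auto)
  qed
  then have "hk_eq V E (a # u) (a # p @ q)" by (rule hk_eq_Cons)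
  with move show ?case by (blast intro: hk_eq_trans hk_eq_sym)
qed

section \<open>Oriented paths and tight words\<close>

lemma opath_iff_successively:
  "opath V E p \<longleftrightarrow> p \<noteq> [] \<and> set p \<subseteq> V \<and> distinct p \<and> successively E p"
  by (auto simp: opath_def successively_conv_nth)

lemma opath_rev: "opath V (\<lambda>a b. E b a) (rev p) \<longleftrightarrow> opath V E p"
  by (simp add: opath_iff_successively)

lemma finite_opaths:
  assumes "finite V"
  shows "finite {p. opath V E p \<and> P p}"
proof (rule finite_subset)
  show "{p. opath V E p \<and> P p} \<subseteq> {p. set p \<subseteq> V \<and> length p \<le> card V}"
    by (auto simp: opath_def) (metis assms card_mono distinct_card)
  show "finite {p. set p \<subseteq> V \<and> length p \<le> card V}"
    using finite_lists_length_le[OF assms] .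
qed

lemma successively_imp_rtranclp: "successively E p \<Longrightarrow> p \<noteq> [] \<Longrightarrow> E\<^sup>*\<^sup>* (hd p) (last p)"
proof (induction p)
  case (Cons a p)
  then show ?case
    by (cases "p = []") (auto simp: successively_Cons intro: converse_rtranclp_into_rtranclp)
qed simp

lemma opath_imp_rtranclp: "opath V E p \<Longrightarrow> E\<^sup>*\<^sup>* (hd p) (last p)"
  by (simp add: opath_iff_successively successively_imp_rtranclp)

lemma rtranclp_imp_opath:
  assumes "E\<^sup>*\<^sup>* a b" "a \<in> V" "\<And>x y. E x y \<Longrightarrow> y \<in> V"
  shows "\<exists>p. opath V E p \<and> hd p = a \<and> last p = b"
  using assms(1)
proof (induction rule: rtranclp_induct)
  case base
  show ?case by (rule exI[of _ "[a]"]) (use assms in \<open>auto simp: opath_def\<close>)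
next
  case (step b c)
  then obtain p where p: "opath V E p" "hd p = a" "last p = b" by blast
  show ?case
  proof (cases "c \<in> set p")
    case True
    then obtain q r where "p = (q @ [c]) @ r" by (metis append.assoc append_Cons append_Nil split_list)
    then show ?thesis using p
      by (intro exI[of _ "q @ [c]"]) (auto simp: opath_iff_successively successively_append_iff hd_append)
  next
    case False
    then show ?thesis using p step(2) assms(3)
      by (intro exI[of _ "p @ [c]"]) (auto simp: opath_iff_successively successively_append_iff)
  qed
qed

lemma edge_in_cycle_if_return:
  assumes "simple_oriented_graph V E" "E a b" "E\<^sup>*\<^sup>* b a"
  shows "\<exists>C\<in>cycles V E. (a, b) \<in> C"
proof -
  have b: "b \<in> V" and V: "\<And>x y. E x y \<Longrightarrow> y \<in> V"
    using assms(1,2) by (auto simp: simple_oriented_graph_def)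
  obtain p where p: "opath V E p" "hd p = b" "last p = a"
    using rtranclp_imp_opath[OF assms(3) b] V by blast
  then have ne: "p \<noteq> []" by (simp add: opath_def)
  \<comment> \<open>Lengths 1 and 2 would give a loop or a pair of opposite arrows.\<close>
  have "length p \<noteq> 1"
    using p assms(1,2) ne by (auto simp: length_Suc_conv simple_oriented_graph_def)
  moreover have "length p \<noteq> 2"
    using p assms(1,2) by (auto simp: numeral_2_eq_2 length_Suc_conv opath_iff_successively
        simple_oriented_graph_def)
  moreover have "length p \<noteq> 0" using ne by simp
  ultimately have len: "length p \<ge> 3" by linarith
  have "E (p ! i) (p ! (Suc i mod length p))" if "i < length p" for i
  proof (cases "Suc i = length p")
    case True
    then have "p ! i = a" using p(3) ne by (simp add: last_conv_nth flip: True)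
    with True show ?thesis using p(2) ne assms(2) by (simp add: hd_conv_nth)
  qed (use p that in \<open>simp add: opath_def\<close>)
  then have "cycle_list V E p" using len p(1) by (auto simp: cycle_list_def opath_def)
  moreover have "(a, b) \<in> cycle_arrows p"
    unfolding cycle_arrows_def mem_Collect_eq
    by (rule exI[of _ "length p - 1"]) (use ne p in \<open>auto simp: hd_conv_nth last_conv_nth\<close>)
  ultimately show ?thesis by (auto simp: cycles_def)
qed

text \<open>For finite \<open>V\<close> these conditions make the arrows into \<open>S\<close>
  well-founded. The notion is applied to \<open>below\<close> with \<open>E\<close> and to
  \<open>above\<close> with the opposite relation.\<close>

definition acyclic_lower_set :: "'v set \<Rightarrow> ('v \<Rightarrow> 'v \<Rightarrow> bool) \<Rightarrow> 'v set \<Rightarrow> bool" where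
  "acyclic_lower_set V E S \<longleftrightarrow>
     S \<subseteq> V \<and> (\<forall>x\<in>S. \<forall>z. E z x \<longrightarrow> z \<in> S) \<and> (\<forall>x\<in>S. \<not> E\<^sup>+\<^sup>+ x x)"

lemma acyclic_lower_set_acyclic:
  assumes "acyclic_lower_set V E S"
  shows "acyclic {(z, x). E z x \<and> x \<in> S}"
proof (rule acyclicI, intro allI notI)
  fix x assume "(x, x) \<in> {(z, x). E z x \<and> x \<in> S}\<^sup>+"
  then have "(x, x) \<in> {(z, x). E z x}\<^sup>+" "x \<in> S"
    by (rule trancl_mono, blast) (use \<open>(x, x) \<in> _\<close> in \<open>auto elim: tranclE\<close>)
  then show False using assms by (auto simp: acyclic_lower_set_def trancl_def)
qed

lemma acyclic_lower_set_induct [consumes 3, case_names step]: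
  assumes "acyclic_lower_set V E S" "finite V" "x \<in> S"
    and step: "\<And>x. x \<in> S \<Longrightarrow> (\<And>z. E z x \<Longrightarrow> z \<in> S \<Longrightarrow> P z) \<Longrightarrow> P x"
  shows "P x"
proof -
  have fin: "finite {(z, x). E z x \<and> x \<in> S}"
    by (rule finite_subset[of _ "V \<times> V"])
      (use assms(1,2) in \<open>auto simp: acyclic_lower_set_def\<close>)
  have "wf {(z, x). E z x \<and> x \<in> S}"
    using fin acyclic_lower_set_acyclic[OF assms(1)] by (rule finite_acyclic_wf)
  then have "x \<in> S \<longrightarrow> P x"
  proof (induction x rule: wf_induct_rule)
    case (less x)
    show ?case
    proof
      assume x: "x \<in> S"
      show "P x" by (rule step[OF x]) (use less x in auto)
    qed
  qed
  with assms(3) show ?thesis by blast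
qed

definition paths_to :: "'v set \<Rightarrow> ('v \<Rightarrow> 'v \<Rightarrow> bool) \<Rightarrow> 'v \<Rightarrow> nat" where
  "paths_to V E x = card {p. opath V E p \<and> last p = x}"

text \<open>A path to \<open>x\<close> other than \<open>[x]\<close> arises by appending
  \<open>x\<close> to a path to a predecessor. Conversely the extended path repeats no vertex, since
  otherwise \<open>x\<close> would return to itself. The \<open>Suc\<close> is the path of length
  0.\<close>

lemma paths_to_rec:
  assumes S: "acyclic_lower_set V E S" and V: "finite V" and x: "x \<in> S"
  shows "paths_to V E x = Suc (\<Sum>z | E z x. paths_to V E z)"
proof -
  have lower: "z \<in> S" if "E z x" for z using S x that by (auto simp: acyclic_lower_set_def)
  have SV: "S \<subseteq> V" using S by (simp add: acyclic_lower_set_def)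
  have fin: "finite {z. E z x}" by (rule finite_subset[OF _ V]) (use lower SV in blast)
  let ?P = "\<lambda>x. {p. opath V E p \<and> last p = x}"
  have "?P x = insert [x] (\<Union>z\<in>{z. E z x}. (\<lambda>p. p @ [x]) ` ?P z)" (is "_ = ?R")
  proof (intro equalityI subsetI)
    fix p assume p: "p \<in> ?P x"
    then have ne: "p \<noteq> []" by (simp add: opath_def)
    obtain q where q: "p = q @ [x]" using ne p by (metis (mono_tags, lifting) append_butlast_last_id mem_Collect_eq)
    show "p \<in> ?R"
    proof (cases "q = []")
      case False
      then have "E (last q) x" "opath V E q"
        using p q by (auto simp: opath_iff_successively successively_append_iff)
      then show ?thesis using q by blast
    qed (use q in simp)
  next
    fix p assume "p \<in> ?R"
    then consider "p = [x]" | z q where "E z x" "p = q @ [x]" "opath V E q" "last q = z" by auto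
    then show "p \<in> ?P x"
    proof cases
      case 1
      then show ?thesis using x SV by (auto simp: opath_def)
    next
      case 2
      have "x \<notin> set q"
      proof
        assume "x \<in> set q"
        then obtain q1 q2 where "q = q1 @ x # q2" by (meson split_list)
        then have "successively E (x # q2)" "last (x # q2) = z"
          using 2 by (auto simp: opath_iff_successively successively_append_iff)
        from successively_imp_rtranclp[OF this(1)] this(2) have "E\<^sup>*\<^sup>* x z" by simp
        with 2(1) have "E\<^sup>+\<^sup>+ x x" by (rule rtranclp_into_tranclp1[rotated])
        then show False using S x by (simp add: acyclic_lower_set_def)
      qed
      then show ?thesis using 2 x SV
        by (auto simp: opath_iff_successively successively_append_iff)
    qed
  qed
  moreover have "[x] \<notin> (\<Union>z\<in>{z. E z x}. (\<lambda>p. p @ [x]) ` ?P z)" by (auto simp: opath_def)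
  moreover have "finite (?P z)" for z by (rule finite_opaths[OF V])
  moreover have "card (\<Union>z\<in>{z. E z x}. (\<lambda>p. p @ [x]) ` ?P z)
      = (\<Sum>z | E z x. card ((\<lambda>p. p @ [x]) ` ?P z))"
    by (rule card_UN_disjoint) (use fin finite_opaths[OF V] in auto)
  moreover have "card ((\<lambda>p. p @ [x]) ` ?P z) = card (?P z)" for z
    by (rule card_image) (auto simp: inj_on_def)
  ultimately show ?thesis using fin by (simp add: paths_to_def)
qed

lemma paths_to_converse:
  "paths_to V (\<lambda>a b. E b a) x = card {p. opath V E p \<and> hd p = x}"
proof -
  have "rev ` {p. opath V E p \<and> hd p = x} = {p. opath V (\<lambda>a b. E b a) p \<and> last p = x}"
  proof (intro equalityI subsetI)
    fix p assume "p \<in> {p. opath V (\<lambda>a b. E b a) p \<and> last p = x}"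
    then have "rev p \<in> {p. opath V E p \<and> hd p = x}"
      using opath_rev[of V E "rev p"] by (auto simp: hd_rev)
    then show "p \<in> rev ` {p. opath V E p \<and> hd p = x}" by (metis imageI rev_rev_ident)
  qed (auto simp: opath_rev last_rev)
  moreover have "card (rev ` {p. opath V E p \<and> hd p = x}) = card {p. opath V E p \<and> hd p = x}"
    by (rule card_image) (auto simp: inj_on_def)
  ultimately show ?thesis by (simp add: paths_to_def)
qed

text \<open>Along a tight word, recomputing the value of each letter read as one plus the sum of the
  values of its predecessors raises it by exactly one, so the values are occurrence counts.\<close>

inductive tight :: "('v \<Rightarrow> 'v \<Rightarrow> bool) \<Rightarrow> 'v list \<Rightarrow> bool" for E where
  Nil: "tight E []"
| snoc: "tight E u \<Longrightarrow> count_list u x = (\<Sum>z | E z x. count_list u z) \<Longrightarrow> tight E (u @ [x])"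

lemma tight_Nil [simp]: "tight E []"
  by (rule tight.Nil)

lemma tight_snoc_iff [simp]:
  "tight E (u @ [x]) \<longleftrightarrow> tight E u \<and> count_list u x = (\<Sum>z | E z x. count_list u z)"
  by (auto intro: tight.snoc elim: tight.cases)

fun insert_after :: "'v \<Rightarrow> ('v \<Rightarrow> bool) \<Rightarrow> 'v list \<Rightarrow> 'v list" where
  "insert_after x Q [] = []"
| "insert_after x Q (y # u) = y # (if Q y then [x] else []) @ insert_after x Q u"

lemma insert_after_append [simp]:
  "insert_after x Q (u @ v) = insert_after x Q u @ insert_after x Q v"
  by (induction u) simp_all

lemma count_insert_after_other: "y \<noteq> x \<Longrightarrow> count_list (insert_after x Q u) y = count_list u y"
proof (induction u)
  case (Cons a u)
  then show ?case by (cases "Q a") simp_all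
qed simp

text \<open>As \<open>x\<close> has no arrow into the letters of \<open>u\<close>, their tightness
  is not disturbed. One \<open>x\<close> in front and one behind each predecessor keep its count at
  one plus the sum over its predecessors; only just before an insertion are the two equal, as
  tightness requires.\<close>

lemma tight_word_insert:
  assumes S: "finite {z. E z x}" and "tight E u" "x \<notin> set u" "\<forall>y\<in>set u. \<not> E x y" "\<not> E x x"
  shows "tight E (x # insert_after x (\<lambda>y. E y x) u) \<and>
    count_list (x # insert_after x (\<lambda>y. E y x) u) x = Suc (\<Sum>z | E z x. count_list u z)"
  using assms(2-4)
proof (induction rule: tight.induct)
  case Nil
  then show ?case using tight_snoc_iff[of E "[]" x] by simp
next
  case (snoc u y)
  let ?u = "x # insert_after x (\<lambda>y. E y x) u"
  have IH: "tight E ?u" "count_list ?u x = Suc (\<Sum>z | E z x. count_list u z)"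
    using snoc.IH snoc.prems by auto
  have y: "y \<noteq> x" "\<not> E x y" using snoc.prems by auto
  have other: "count_list ?u z = count_list u z" if "z \<noteq> x" for z
    using that by (simp add: count_insert_after_other)
  have "(\<Sum>z | E z y. count_list ?u z) = (\<Sum>z | E z y. count_list u z)"
    by (rule sum.cong) (use y other in auto)
  then have ty: "tight E (?u @ [y])"
    unfolding tight_snoc_iff using IH(1) other[OF y(1)] snoc.hyps(2) by presburger
  have sum: "(\<Sum>z | E z x. count_list (?u @ [y]) z) = (\<Sum>z | E z x. count_list (u @ [y]) z)"
    by (rule sum.cong) (use assms(5) other in auto)
  have "(\<Sum>z | E z x. count_list [y] z) = (if E y x then 1 else 0)"
  proof -
    have "(\<Sum>z | E z x. count_list [y] z) = (\<Sum>z | E z x. if y = z then 1 else 0)"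
      by (rule sum.cong) auto
    then show ?thesis using S by simp
  qed
  then have add: "(\<Sum>z | E z x. count_list (u @ [y]) z)
      = (\<Sum>z | E z x. count_list u z) + (if E y x then 1 else 0)"
    unfolding count_list_append sum.distrib by (rule arg_cong)
  have cx: "count_list (?u @ [y]) x = Suc (\<Sum>z | E z x. count_list u z)"
    using IH(2) y(1) by simp
  show ?case
  proof (cases "E y x")
    case True
    have "tight E ((?u @ [y]) @ [x])"
      by (rule tight.snoc[OF ty]) (use cx sum add True in presburger)
    moreover have "x # insert_after x (\<lambda>y. E y x) (u @ [y]) = (?u @ [y]) @ [x]"
      using True by simp
    moreover have "count_list ((?u @ [y]) @ [x]) x = Suc (\<Sum>z | E z x. count_list (u @ [y]) z)"
      unfolding add count_list_append[of "?u @ [y]"] cx using True by simp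
    ultimately show ?thesis by argo
  next
    case False
    then have "x # insert_after x (\<lambda>y. E y x) (u @ [y]) = ?u @ [y]" by simp
    then show ?thesis using ty cx add False by presburger
  qed
qed

lemma set_insert_after: "set (insert_after x Q u) \<subseteq> insert x (set u)"
proof (induction u)
  case (Cons a u)
  then show ?case by (cases "Q a") auto
qed simp

text \<open>Induction on the size of the predecessor-closed set \<open>T\<close>: a sink of
  \<open>T\<close> is removed, which leaves a predecessor-closed set, and is put back by
  \<open>tight_word_insert\<close>. Its count then obeys the path recursion.\<close>

lemma tight_word_exists_aux:
  assumes S: "acyclic_lower_set V E S" and V: "finite V"
    and T: "T \<subseteq> S" "\<forall>x\<in>T. \<forall>z. E z x \<longrightarrow> z \<in> T"
  shows "\<exists>u. set u \<subseteq> T \<and> tight E u \<and> (\<forall>x\<in>T. count_list u x = paths_to V E x)"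
  using T
proof (induction "card T" arbitrary: T)
  case 0
  have "finite T" using 0 S V by (meson acyclic_lower_set_def finite_subset)
  then show ?case using 0 by (intro exI[of _ "[]"]) auto
next
  case (Suc n)
  have "finite T" using Suc.prems S V by (meson acyclic_lower_set_def finite_subset)
  have "finite {(z, x). E z x \<and> x \<in> S}"
    by (rule finite_subset[of _ "V \<times> V"]) (use S V in \<open>auto simp: acyclic_lower_set_def\<close>)
  then have wf: "wf ({(z, x). E z x \<and> x \<in> S}\<inverse>)"
    using acyclic_lower_set_acyclic[OF S] by (rule finite_acyclic_wf_converse)
  have "T \<noteq> {}" using Suc.hyps(2) by auto
  then obtain x where x: "x \<in> T" "\<forall>y. E x y \<and> y \<in> S \<longrightarrow> y \<notin> T"
    using wfE_min'[OF wf, of T] by (metis (no_types, lifting) case_prodI converseI mem_Collect_eq)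
  then have nox: "\<not> E x y" if "y \<in> T" for y using that Suc.prems by blast
  have "n = card (T - {x})" using Suc.hyps(2) x \<open>finite T\<close> by simp
  from Suc.hyps(1)[OF this] obtain u where u: "set u \<subseteq> T - {x}" "tight E u"
    "\<forall>y\<in>T - {x}. count_list u y = paths_to V E y"
    using Suc.prems nox by blast
  let ?u = "x # insert_after x (\<lambda>y. E y x) u"
  have fin: "finite {z. E z x}"
    by (rule finite_subset[OF _ \<open>finite T\<close>]) (use Suc.prems x in blast)
  have t: "tight E ?u" "count_list ?u x = Suc (\<Sum>z | E z x. count_list u z)"
    using tight_word_insert[OF fin u(2)] u(1) nox x(1) by auto
  have "z \<in> T - {x}" if "E z x" for z using that nox x(1) Suc.prems(2) by blast
  then have "(\<Sum>z | E z x. count_list u z) = (\<Sum>z | E z x. paths_to V E z)"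
    by (intro sum.cong refl) (use u(3) in blast)
  then have cx: "count_list ?u x = paths_to V E x"
    using t(2) paths_to_rec[OF S V, of x] x(1) Suc.prems(1) by force
  have cy: "count_list ?u y = paths_to V E y" if "y \<in> T - {x}" for y
    using u(3) that by (auto simp: count_insert_after_other)
  have "set ?u \<subseteq> T"
    using set_insert_after[of x "\<lambda>y. E y x" u] u(1) x(1) unfolding list.set by blast
  have "\<forall>y\<in>T. count_list ?u y = paths_to V E y" using cx cy by blast
  with \<open>set ?u \<subseteq> T\<close> t(1) show ?case by blast
qed

lemma tight_word_exists:
  assumes "acyclic_lower_set V E S" "finite V"
  obtains u where "set u \<subseteq> S" "tight E u" "\<And>x. x \<in> S \<Longrightarrow> count_list u x = paths_to V E x"
proof -
  have "\<forall>x\<in>S. \<forall>z. E z x \<longrightarrow> z \<in> S" using assms(1) by (auto simp: acyclic_lower_set_def)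
  then show ?thesis using tight_word_exists_aux[OF assms subset_refl] that by blast
qed

section \<open>Invariants from asynchronous updates\<close>

definition run :: "('v \<Rightarrow> ('v \<Rightarrow> 'b) \<Rightarrow> 'b) \<Rightarrow> 'v list \<Rightarrow> ('v \<Rightarrow> 'b) \<Rightarrow> ('v \<Rightarrow> 'b)" where
  "run F w s = fold (\<lambda>v s. s(v := F v s)) w s"

lemma run_Nil [simp]: "run F [] s = s"
  and run_Cons [simp]: "run F (v # w) s = run F w (s(v := F v s))"
  and run_append [simp]: "run F (u @ w) s = run F w (run F u s)"
  by (simp_all add: run_def)

lemma run_notin: "v \<notin> set w \<Longrightarrow> run F w s v = s v"
  by (induction w arbitrary: s) auto

text \<open>Updates at non-adjacent vertices commute, and without loops a repeated update changes
  nothing. For an arrow from \<open>a\<close> to \<open>b\<close>, the vertex \<open>a\<close> does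
  not read \<open>b\<close>: in \<open>aba\<close> the second update of \<open>a\<close> recomputes
  the same value, and in \<open>bab\<close> the first update of \<open>b\<close> is overwritten
  before anything has read it.\<close>

lemma run_hk_eq:
  assumes graph: "simple_oriented_graph V E"
    and reads: "\<And>v s s'. (\<And>z. E z v \<Longrightarrow> s z = s' z) \<Longrightarrow> F v s = F v s'"
    and "hk_eq V E u w"
  shows "run F u = run F w"
proof -
  have upd: "F v (s(y := t)) = F v s" if "\<not> E y v" for v s y t
    by (rule reads) (use that in auto)
  have irr: "\<not> E a a" and asym: "E a b \<Longrightarrow> \<not> E b a" for a b
    using graph by (auto simp: simple_oriented_graph_def)
  have step: "run F x = run F y" if "hk_step V E x y" for x y
    using that
  proof cases
    case (idem a p q)
    then show ?thesis by (auto simp: upd irr)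
  next
    case (comm a b p q)
    then show ?thesis by (cases "a = b") (auto simp: upd irr fun_upd_twist)
  next
    case (arr1 a b p q)
    then have "a \<noteq> b" "\<not> E b a" "\<not> E a a" using irr asym by auto
    with arr1(1,2) show ?thesis by (auto simp: upd fun_upd_twist intro!: arg_cong[where f="\<lambda>s. run F q s _"])
  next
    case (arr2 a b p q)
    then have "a \<noteq> b" "\<not> E b a" "\<not> E b b" using irr asym by auto
    with arr2(1,2) show ?thesis by (auto simp: upd fun_upd_twist intro!: arg_cong[where f="\<lambda>s. run F q s _"])
  qed
  show ?thesis using assms(3) by (induction rule: hk_eq_induct) (use step in auto)
qed

text \<open>Here \<open>r\<close> is the number of letters \<open>z\<close> still to be met before
  letters \<open>c\<close> count; truncated subtraction keeps it at 0 from then on.\<close>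

fun occ_after :: "'v \<Rightarrow> nat \<Rightarrow> 'v \<Rightarrow> 'v list \<Rightarrow> nat" where
  "occ_after z r c [] = 0"
| "occ_after z r c (a # w) =
     (if a = c \<and> r = 0 then 1 else 0) + occ_after z (if a = z then r - 1 else r) c w"

lemma occ_after_append:
  "occ_after z r c (u @ w) = occ_after z r c u + occ_after z (r - count_list u z) c w"
  by (induction u arbitrary: r) auto

lemma occ_after_0 [simp]: "occ_after z 0 c w = count_list w c"
  by (induction w) auto

lemma occ_after_eq_0: "count_list w z < r \<Longrightarrow> occ_after z r c w = 0"
proof (induction w arbitrary: r)
  case (Cons a w)
  then show ?case by (cases "a = z") auto
qed simp

lemma occ_after_notin: "c \<notin> set w \<Longrightarrow> occ_after z r c w = 0"
  by (induction w arbitrary: r) auto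

lemma occ_after_snoc:
  "occ_after z r c (w @ [a]) = occ_after z r c w + (if a = c \<and> r \<le> count_list w z then 1 else 0)"
  by (auto simp: occ_after_append)

text \<open>With \<open>r\<close> one larger than the count of \<open>z\<close> in \<open>u\<close>,
  counting starts exactly at the displayed \<open>z\<close>. In this form the invariant yields
  exponents.\<close>

lemma occ_after_split:
  assumes "c \<noteq> z"
  shows "occ_after z (Suc (count_list u z)) c (u @ z # w) = count_list w c"
  using assms by (simp add: occ_after_append occ_after_eq_0)

text \<open>By tightness the count of a letter just before it is read equals the sum over its
  predecessors, so the update adds one. Letters outside \<open>S\<close> cannot interfere,
  \<open>S\<close> being closed under predecessors.\<close>

lemma run_eq_count_list:
  assumes lower: "\<And>x z. x \<in> S \<Longrightarrow> E z x \<Longrightarrow> z \<in> S"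
    and F: "\<And>v s. v \<in> S \<Longrightarrow> F v s = Suc (\<Sum>z | E z v. s z)"
    and "tight E (filter (\<lambda>x. x \<in> S) w)" "v \<in> S"
  shows "run F w (\<lambda>_. 0) v = count_list w v"
  using assms(3,4)
proof (induction w arbitrary: v rule: rev_induct)
  case (snoc x w)
  show ?case
  proof (cases "x \<in> S")
    case True
    have cnt: "count_list (filter (\<lambda>x. x \<in> S) w) z = count_list w z" if "z \<in> S" for z
      using that by (induction w) auto
    have t: "tight E (filter (\<lambda>x. x \<in> S) w)" "count_list w x = (\<Sum>z | E z x. count_list w z)"
    proof -
      have "tight E (filter (\<lambda>x. x \<in> S) w)"
        "count_list w x = (\<Sum>z | E z x. count_list (filter (\<lambda>x. x \<in> S) w) z)"
        using snoc.prems True cnt[OF True] by auto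
      moreover have "(\<Sum>z | E z x. count_list (filter (\<lambda>x. x \<in> S) w) z)
          = (\<Sum>z | E z x. count_list w z)"
        by (rule sum.cong) (use cnt lower True in auto)
      ultimately show "tight E (filter (\<lambda>x. x \<in> S) w)"
        "count_list w x = (\<Sum>z | E z x. count_list w z)" by auto
    qed
    have "(\<Sum>z | E z x. run F w (\<lambda>_. 0) z) = (\<Sum>z | E z x. count_list w z)"
      by (rule sum.cong) (use snoc.IH[OF t(1)] lower True in auto)
    then show ?thesis using snoc.IH[OF t(1)] snoc.prems(2) F[OF True] t(2) by auto
  next
    case False
    then show ?thesis using snoc by auto
  qed
qed simp

text \<open>The counter circulating along the cycle letters \<open>K\<close> is incremented at \<open>c\<close> as soon as the
  letter \<open>z\<close>, whose value counts its own occurrences, has been met \<open>r\<close> times. So its final value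
  is an invariant of the monoid element.\<close>

lemma occ_after_invariant:
  assumes graph: "simple_oriented_graph V E"
    and lower: "\<And>x z. x \<in> S \<Longrightarrow> E z x \<Longrightarrow> z \<in> S"
    and K: "K \<inter> S = {}" "\<And>v. v \<in> K \<Longrightarrow> E (pr v) v \<and> pr v \<in> K" and c: "c \<in> K"
    and z: "r = 0 \<or> z \<in> S \<and> E z c"
    and eq: "hk_eq V E w w'"
    and w: "tight E (filter (\<lambda>x. x \<in> S) w)" "successively (\<lambda>a b. a = pr b) (filter (\<lambda>x. x \<in> K) w)"
    and w': "tight E (filter (\<lambda>x. x \<in> S) w')" "successively (\<lambda>a b. a = pr b) (filter (\<lambda>x. x \<in> K) w')"
    and ne: "filter (\<lambda>x. x \<in> K) w \<noteq> []" "filter (\<lambda>x. x \<in> K) w' \<noteq> []"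
    and last: "last (filter (\<lambda>x. x \<in> K) w) = last (filter (\<lambda>x. x \<in> K) w')"
  shows "occ_after z r c w = occ_after z r c w'"
proof -
  \<comment> \<open>Inside \<open>S\<close> the states count occurrences; on \<open>K\<close> a
    letter copies the counter of its predecessor \<open>pr v\<close>. Only in-neighbours are read:
    \<open>pr v\<close> and, for \<open>v = c\<close> and positive \<open>r\<close>, also
    \<open>z\<close>.\<close>
  define F where "F v s = (if v \<in> S then Suc (\<Sum>z | E z v. s z)
    else if v \<in> K then s (pr v) + (if v = c \<and> (r = 0 \<or> r \<le> s z) then 1 else 0) else (0::nat))" for v s
  have reads: "F v s = F v s'" if "\<And>z. E z v \<Longrightarrow> s z = s' z" for v s s'
  proof -
    have "(\<Sum>z | E z v. s z) = (\<Sum>z | E z v. s' z)" by (rule sum.cong) (use that in auto)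
    then show ?thesis using that K(2)[of v] z by (auto simp: F_def)
  qed
  have FS: "F v s = Suc (\<Sum>z | E z v. s z)" if "v \<in> S" for v s using that by (simp add: F_def)
  \<comment> \<open>The counter sits at the cycle letter read last, since the next cycle letter
    fetches it from there.\<close>
  have val: "run F u (\<lambda>_. 0) (last (filter (\<lambda>x. x \<in> K) u)) = occ_after z r c u"
    if "tight E (filter (\<lambda>x. x \<in> S) u)" "successively (\<lambda>a b. a = pr b) (filter (\<lambda>x. x \<in> K) u)"
      "filter (\<lambda>x. x \<in> K) u \<noteq> []" for u
    using that
  proof (induction u rule: rev_induct)
    case (snoc b u)
    have t: "tight E (filter (\<lambda>x. x \<in> S) u)" using snoc.prems(1) by (cases "b \<in> S") auto
    have cnt: "run F u (\<lambda>_. 0) v = count_list u v" if "v \<in> S" for v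
      by (rule run_eq_count_list[where E = E and S = S]) (use lower FS t that in auto)
    show ?case
    proof (cases "b \<in> K")
      case True
      then have bS: "b \<notin> S" using K by auto
      have "b = c \<and> (r = 0 \<or> r \<le> run F u (\<lambda>_. 0) z) \<longleftrightarrow> b = c \<and> r \<le> count_list u z"
        using z cnt[of z] by auto
      moreover have "run F u (\<lambda>_. 0) (pr b) = occ_after z r c u"
      \<comment> \<open>At the first cycle letter the value fetched is the initial 0, and no
        \<open>c\<close> has been read yet.\<close>
      proof (cases "filter (\<lambda>x. x \<in> K) u = []")
        case True
        then have "x \<notin> set u" if "x \<in> K" for x using that by (auto simp: filter_empty_conv)
        then show ?thesis using K(2)[OF \<open>b \<in> K\<close>] c by (simp add: run_notin occ_after_notin)
      next
        case False
        then show ?thesis using snoc t True \<open>b \<in> K\<close> by (auto simp: successively_append_iff)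
      qed
      moreover have "F b s = s (pr b) + (if b = c \<and> (r = 0 \<or> r \<le> s z) then 1 else 0)" for s
        using True bS by (simp add: F_def)
      ultimately show ?thesis using True by (simp add: occ_after_snoc)
    next
      case False
      then have "last (filter (\<lambda>x. x \<in> K) u) \<noteq> b"
        using snoc.prems(3) last_in_set[of "filter (\<lambda>x. x \<in> K) u"] by auto
      then show ?thesis using snoc t False c by (auto simp: occ_after_snoc)
    qed
  qed simp
  have "run F w = run F w'" by (rule run_hk_eq[OF graph reads eq])
  then show ?thesis using val[OF w ne(1)] val[OF w' ne(2)] last by simp
qed

section \<open>Graphs with separated cycles\<close>

lemma cycle_arrows_iff:
  "(a, b) \<in> cycle_arrows cs \<longleftrightarrow> (\<exists>i<length cs. a = cs ! i \<and> b = cs ! (Suc i mod length cs))"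
  by (auto simp: cycle_arrows_def)

lemma cverts_cycle_arrows: "cverts (cycle_arrows cs) = set cs"
proof -
  have "cverts (cycle_arrows cs) = (\<lambda>i. cs ! i) ` {..<length cs}"
    by (auto simp: cverts_def cycle_arrows_def image_iff)
  then show ?thesis by (auto simp: set_conv_nth)
qed

lemma cycle_list_reach:
  assumes "cycle_list V E cs" "a \<in> set cs" "b \<in> set cs"
  shows "E\<^sup>*\<^sup>* a b"
proof -
  have E: "E (cs ! i) (cs ! (Suc i mod length cs))" if "i < length cs" for i
    using assms(1) that by (simp add: cycle_list_def)
  have up: "E\<^sup>*\<^sup>* (cs ! i) (cs ! j)" if "i \<le> j" "j < length cs" for i j
    using that
  proof (induction j rule: dec_induct)
    case (step j)
    then show ?case using E[of j] by (auto intro: rtranclp.rtrancl_into_rtrancl)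
  qed simp
  have len: "length cs > 0" using assms(1) by (auto simp: cycle_list_def)
  have wrap: "E (cs ! (length cs - 1)) (cs ! 0)" using E[of "length cs - 1"] len by simp
  obtain i j where ij: "i < length cs" "j < length cs" "a = cs ! i" "b = cs ! j"
    using assms(2,3) by (metis in_set_conv_nth)
  have "E\<^sup>*\<^sup>* (cs ! i) (cs ! (length cs - 1))" "E\<^sup>*\<^sup>* (cs ! 0) (cs ! j)"
    using up ij len by auto
  with wrap show ?thesis unfolding ij
    by (meson rtranclp.rtrancl_into_rtrancl rtranclp_trans)
qed

lemma tranclp_flip: "(\<lambda>a b. E b a)\<^sup>+\<^sup>+ x y \<longleftrightarrow> E\<^sup>+\<^sup>+ y x"
proof -
  have "(\<lambda>a b. E b a) = E\<inverse>\<inverse>" by (simp add: fun_eq_iff)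
  then show ?thesis by (simp add: tranclp_converse)
qed

locale separated_cycles =
  fixes V :: "'v set" and E :: "'v \<Rightarrow> 'v \<Rightarrow> bool"
  assumes graph: "simple_oriented_graph V E"
    and no_conn: "\<forall>C1 \<in> cycles V E. \<forall>C2 \<in> cycles V E. C1 \<noteq> C2 \<longrightarrow>
                    \<not> (\<exists>p. opath V E p \<and> hd p \<in> cverts C1 \<and> last p \<in> cverts C2)"
begin

lemma finite_V: "finite V" and edge_in_V: "E a b \<Longrightarrow> a \<in> V \<and> b \<in> V"
  and edge_irrefl: "\<not> E a a"
  using graph by (auto simp: simple_oriented_graph_def)

lemma graph_converse: "simple_oriented_graph V (\<lambda>a b. E b a)"
  using graph by (auto simp: simple_oriented_graph_def)

lemma cycleE:
  assumes "C \<in> cycles V E"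
  obtains cs where "cycle_list V E cs" "C = cycle_arrows cs" "cverts C = set cs"
  using assms by (auto simp: cycles_def cverts_cycle_arrows)

lemma arrow_verts:
  assumes "C \<in> cycles V E" "(a, b) \<in> C"
  shows "a \<in> cverts C" "b \<in> cverts C" "E a b"
proof -
  obtain cs where cs: "cycle_list V E cs" "C = cycle_arrows cs" "cverts C = set cs"
    using assms(1) by (rule cycleE)
  have "Suc i mod length cs < length cs" if "i < length cs" for i
    by (rule mod_less_divisor) (use that in auto)
  with cs assms(2) show "a \<in> cverts C" "b \<in> cverts C" "E a b"
    by (auto simp: cycle_arrows_iff cycle_list_def)
qed

lemma cverts_subset: "C \<in> cycles V E \<Longrightarrow> cverts C \<subseteq> V"
  by (erule cycleE) (auto simp: cycle_list_def)

lemma cycle_reach: "C \<in> cycles V E \<Longrightarrow> a \<in> cverts C \<Longrightarrow> b \<in> cverts C \<Longrightarrow> E\<^sup>*\<^sup>* a b"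
  by (erule cycleE) (auto intro: cycle_list_reach)

lemma finite_cycles: "finite (cycles V E)" "C \<in> cycles V E \<Longrightarrow> finite C"
proof -
  have sub: "cycles V E \<subseteq> Pow (V \<times> V)"
    using arrow_verts(3) edge_in_V by fast
  then show "finite (cycles V E)" by (rule finite_subset) (simp add: finite_V)
  show "C \<in> cycles V E \<Longrightarrow> finite C"
    by (rule finite_subset[of _ "V \<times> V"]) (use sub in \<open>auto simp: finite_V\<close>)
qed

text \<open>Paths of length 0 are included, so distinct cycles have no common vertex either.\<close>

lemma connected_cycles_eq:
  assumes "C1 \<in> cycles V E" "C2 \<in> cycles V E" "a \<in> cverts C1" "b \<in> cverts C2" "E\<^sup>*\<^sup>* a b"
  shows "C1 = C2"
proof -
  have "a \<in> V" using assms cverts_subset by auto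
  then obtain p where "opath V E p" "hd p = a" "last p = b"
    using rtranclp_imp_opath[OF assms(5)] edge_in_V by metis
  with assms no_conn show ?thesis by blast
qed

lemma cycle_of_return_edge:
  assumes "E a b" "E\<^sup>*\<^sup>* b a"
  obtains C where "C \<in> cycles V E" "(a, b) \<in> C" "a \<in> cverts C" "b \<in> cverts C"
  using edge_in_cycle_if_return[OF graph assms] arrow_verts by metis

text \<open>The way back along \<open>C\<close> puts the arrow on some cycle, which meets
  \<open>C\<close> in \<open>a\<close> and hence is \<open>C\<close>.\<close>

lemma no_chord:
  assumes "C \<in> cycles V E" "a \<in> cverts C" "b \<in> cverts C" "E a b"
  shows "(a, b) \<in> C"
proof -
  obtain C' where C': "C' \<in> cycles V E" "(a, b) \<in> C'" "a \<in> cverts C'"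
    using cycle_of_return_edge[OF assms(4) cycle_reach[OF assms(1,3,2)]] by metis
  have "C = C'" using connected_cycles_eq[OF assms(1) C'(1) assms(2) C'(3)] by simp
  with C' show ?thesis by simp
qed

lemma arrow_unique:
  assumes "C \<in> cycles V E"
  shows "(a, b) \<in> C \<Longrightarrow> (a', b) \<in> C \<Longrightarrow> a = a'" "(a, b) \<in> C \<Longrightarrow> (a, b') \<in> C \<Longrightarrow> b = b'"
proof -
  obtain cs where cs: "cycle_list V E cs" "C = cycle_arrows cs" using assms by (rule cycleE)
  have d: "distinct cs" using cs by (simp add: cycle_list_def)
  show "(a, b) \<in> C \<Longrightarrow> (a, b') \<in> C \<Longrightarrow> b = b'"
    using d nth_eq_iff_index_eq unfolding cs cycle_arrows_iff by fastforce
  assume "(a, b) \<in> C" "(a', b) \<in> C"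
  then obtain i j where ij: "i < length cs" "j < length cs" "a = cs ! i" "a' = cs ! j"
    "cs ! (Suc i mod length cs) = cs ! (Suc j mod length cs)"
    unfolding cs cycle_arrows_iff by auto
  then have "Suc i mod length cs = Suc j mod length cs"
    using d by (subst (asm) nth_eq_iff_index_eq) (auto intro!: mod_less_divisor)
  then have "i = j" using ij(1,2)
    by (auto simp: mod_Suc split: if_splits)
  with ij show "a = a'" by simp
qed

lemma arrow_exists:
  assumes "C \<in> cycles V E" "a \<in> cverts C"
  shows "\<exists>b. (a, b) \<in> C" "\<exists>b. (b, a) \<in> C"
proof -
  obtain cs where cs: "cycle_list V E cs" "C = cycle_arrows cs" "cverts C = set cs"
    using assms(1) by (rule cycleE)
  show "\<exists>b. (a, b) \<in> C" using assms(2) by (auto simp: cverts_def)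
  obtain i where i: "i < length cs" "a = cs ! i" using assms(2) cs by (auto simp: in_set_conv_nth)
  show "\<exists>b. (b, a) \<in> C"
  proof (cases i)
    case 0
    then show ?thesis using i cs unfolding cycle_arrows_iff
      by (intro exI[of _ "last cs"] exI[of _ "length cs - 1"])
        (auto simp: cycle_arrows_iff last_conv_nth cs intro!: exI[of _ "length cs - 1"])
  next
    case (Suc j)
    then show ?thesis using i cs by (auto simp: cycle_arrows_iff intro!: exI[of _ j])
  qed
qed

section \<open>The two sides of the cycles\<close>

definition below :: "'v set" where
  "below = {x \<in> V. x \<notin> cycle_vertices V E \<and> (\<exists>c\<in>cycle_vertices V E. E\<^sup>*\<^sup>* x c)}"

text \<open>Vertices connected with no cycle at all are placed here, so that \<open>below\<close>
  and \<open>above\<close> exhaust the non-cycle vertices.\<close>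

definition above :: "'v set" where
  "above = {x \<in> V. \<forall>c\<in>cycle_vertices V E. \<not> E\<^sup>*\<^sup>* x c}"

lemma return_imp_cycle_vertex:
  assumes "E\<^sup>+\<^sup>+ x x"
  shows "x \<in> cycle_vertices V E"
proof -
  obtain y where "E x y" "E\<^sup>*\<^sup>* y x" using assms by (metis tranclpD)
  then show ?thesis by (rule cycle_of_return_edge) (auto simp: cycle_vertices_def)
qed

text \<open>Separation puts \<open>c\<close> and \<open>d\<close> on one cycle, which leads back
  from \<open>d\<close> to \<open>c\<close>; so \<open>x\<close> lies on a closed walk.\<close>

lemma between_cycle_vertices:
  assumes "c \<in> cycle_vertices V E" "d \<in> cycle_vertices V E" "E\<^sup>*\<^sup>* c x" "E\<^sup>*\<^sup>* x d"
  shows "x \<in> cycle_vertices V E"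
proof -
  obtain C D where CD: "C \<in> cycles V E" "c \<in> cverts C" "D \<in> cycles V E" "d \<in> cverts D"
    using assms(1,2) by (auto simp: cycle_vertices_def)
  have "C = D" by (rule connected_cycles_eq[OF CD(1,3,2,4)]) (use assms in auto)
  then have "E\<^sup>*\<^sup>* d c" using cycle_reach CD by blast
  then have "E\<^sup>*\<^sup>* x c" using assms(4) by auto
  show ?thesis
  proof (cases "x = c")
    case False
    then have "E\<^sup>+\<^sup>+ x c" using \<open>E\<^sup>*\<^sup>* x c\<close> by (metis rtranclpD)
    then show ?thesis using assms(3) return_imp_cycle_vertex by (meson tranclp_rtranclp_tranclp)
  qed (use assms in simp)
qed

lemma below_lower: "acyclic_lower_set V E below"
  unfolding acyclic_lower_set_def
proof (intro conjI ballI allI impI notI)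
  show "below \<subseteq> V" by (auto simp: below_def)
  fix x assume x: "x \<in> below"
  show False if "E\<^sup>+\<^sup>+ x x" using return_imp_cycle_vertex[OF that] x by (auto simp: below_def)
  fix z assume z: "E z x"
  obtain c where c: "c \<in> cycle_vertices V E" "E\<^sup>*\<^sup>* x c" "x \<notin> cycle_vertices V E"
    using x by (auto simp: below_def)
  have "z \<notin> cycle_vertices V E" using between_cycle_vertices[of z c x] c z by auto
  moreover have "E\<^sup>*\<^sup>* z c" using z c(2) by (rule converse_rtranclp_into_rtranclp)
  ultimately show "z \<in> below" using edge_in_V[OF z] c by (auto simp: below_def)
qed

lemma above_lower: "acyclic_lower_set V (\<lambda>a b. E b a) above"
  unfolding acyclic_lower_set_def
proof (intro conjI ballI allI impI notI)
  show "above \<subseteq> V" by (auto simp: above_def)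
  fix x assume x: "x \<in> above"
  show False if "(\<lambda>a b. E b a)\<^sup>+\<^sup>+ x x"
  proof -
    have "x \<in> cycle_vertices V E" using return_imp_cycle_vertex tranclp_flip[of E x x] that by blast
    then show False using x by (auto simp: above_def)
  qed
  fix z assume "E x z"
  then show "z \<in> above" using x edge_in_V[of x z] converse_rtranclp_into_rtranclp[of E x z]
    unfolding above_def by blast
qed

lemma below_above: "below \<inter> above = {}" "below \<union> above = V - cycle_vertices V E"
  "below \<inter> cycle_vertices V E = {}" "above \<inter> cycle_vertices V E = {}"
  by (auto simp: below_def above_def)

text \<open>A neighbour of \<open>C\<close> lies on no other cycle, as the edge would connect the
  two. The condition in \<open>kx\<close> comes down to the direction of one edge: for
  \<open>E x c\<close> the path \<open>[x, c]\<close> starts off \<open>C\<close>, and for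
  \<open>E c x\<close> no path leads from \<open>x\<close> back to \<open>C\<close>.\<close>

lemma adj_set_cases:
  assumes C: "C \<in> cycles V E" and x: "x \<in> adj_set V E C"
  obtains (below) c where "x \<in> below" "c \<in> cverts C" "E x c" "kx V E C x = paths_to V E x"
  | (above) c where "x \<in> above" "c \<in> cverts C" "E c x" "kx V E C x = paths_to V (\<lambda>a b. E b a) x"
proof -
  have Cc: "cverts C \<subseteq> cycle_vertices V E" using C by (auto simp: cycle_vertices_def)
  obtain c where xc: "x \<in> V" "x \<notin> cverts C" "c \<in> cverts C" "E x c \<or> E c x"
    using x by (auto simp: adj_set_def)
  have noncyc: "x \<notin> cycle_vertices V E"
  proof
    assume "x \<in> cycle_vertices V E"
    then obtain D where D: "D \<in> cycles V E" "x \<in> cverts D" by (auto simp: cycle_vertices_def)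
    have "C = D" using xc(4)
      using connected_cycles_eq[OF C D(1) xc(3) D(2)] connected_cycles_eq[OF D(1) C D(2) xc(3)]
      by blast
    then show False using D xc by simp
  qed
  show thesis
  proof (cases "E x c")
    case True
    have "path_between V E (cverts C) x [x, c]" "hd [x, c] \<notin> cverts C"
      using xc True edge_in_V edge_irrefl by (auto simp: path_between_def opath_iff_successively)
    then have "kx V E C x = paths_to V E x" unfolding kx_def paths_to_def by metis
    moreover have "x \<in> below" using noncyc xc True Cc by (auto simp: below_def)
    ultimately show thesis using xc True that(1) by blast
  next
    case False
    then have cx: "E c x" using xc by blast
    have xa: "x \<in> above"
      using between_cycle_vertices[of c _ x] noncyc xc cx Cc by (auto simp: above_def)
    have "hd p \<in> cverts C" if "path_between V E (cverts C) x p" for p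
    proof (rule ccontr)
      assume "hd p \<notin> cverts C"
      then have "E\<^sup>*\<^sup>* x (last p)" "last p \<in> cverts C"
        using that opath_imp_rtranclp[of V E p] by (auto simp: path_between_def)
      then show False using xa Cc by (auto simp: above_def)
    qed
    then have "kx V E C x = paths_to V (\<lambda>a b. E b a) x"
      unfolding kx_def paths_to_converse by simp
    then show thesis using xc cx xa that(2) by blast
  qed
qed

lemma paths_one_sided:
  assumes "x \<notin> cycle_vertices V E"
  shows "(\<forall>p. path_between V E (cycle_vertices V E) x p \<longrightarrow> hd p = x) \<or>
    (\<forall>p. path_between V E (cycle_vertices V E) x p \<longrightarrow> hd p \<in> cycle_vertices V E)"
proof (rule ccontr)
  assume "\<not> ?thesis"
  then obtain p q where "opath V E p" "hd p \<in> cycle_vertices V E" "last p = x"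
    "opath V E q" "hd q = x" "last q \<in> cycle_vertices V E"
    by (auto simp: path_between_def)
  then show False using assms between_cycle_vertices opath_imp_rtranclp by metis
qed

end

section \<open>Reduced words\<close>

definition reduced :: "('v \<Rightarrow> 'v \<Rightarrow> bool) \<Rightarrow> 'v list \<Rightarrow> bool" where
  "reduced E w \<longleftrightarrow> (\<forall>p x u q. w = p @ x # u @ x # q \<longrightarrow> x \<notin> set u \<longrightarrow>
     (\<exists>z\<in>set u. E z x) \<and> (\<exists>z\<in>set u. E x z))"

lemma reducedD:
  assumes "reduced E w" "w = p @ x # u @ x # q" "x \<notin> set u"
  shows "\<exists>z\<in>set u. E z x" "\<exists>z\<in>set u. E x z"
  using assms unfolding reduced_def by blast+

lemma reduced_rev:
  assumes "reduced E w"
  shows "reduced (\<lambda>a b. E b a) (rev w)"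
  unfolding reduced_def
proof (intro allI impI)
  fix p x u q assume w: "rev w = p @ x # u @ x # q" "x \<notin> set u"
  have "rev (rev w) = rev q @ x # rev u @ x # rev p" unfolding w by simp
  then have "w = rev q @ x # rev u @ x # rev p" by simp
  from reducedD[OF assms this] w(2) show "(\<exists>z\<in>set u. E x z) \<and> (\<exists>z\<in>set u. E z x)" by auto
qed

text \<open>A factor \<open>x u x\<close> violating the condition loses one of its outer letters by
  a deletion lemma, so the length drops.\<close>

lemma reduced_exists:
  assumes "set w \<subseteq> V"
  shows "\<exists>w'. set w' \<subseteq> V \<and> hk_eq V E w' w \<and> length w' \<le> length w \<and> reduced E w'"
  using assms
proof (induction w rule: length_induct)
  case (1 w)
  show ?case
  proof (cases "reduced E w")
    case True
    then show ?thesis using 1 by (intro exI[of _ w]) auto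
  next
    case False
    then obtain p x u q where w: "w = p @ (x # u @ [x]) @ q"
      and x: "\<not> (\<exists>z\<in>set u. E z x) \<or> \<not> (\<exists>z\<in>set u. E x z)"
      by (auto simp: reduced_def)
    obtain v where "length v < length (x # u @ [x])" "set v \<subseteq> V" "hk_eq V E (x # u @ [x]) v"
    proof (cases "\<exists>z\<in>set u. E z x")
      case True
      show thesis by (rule that[of "u @ [x]"]) (use hk_eq_delete_left[of x V u E] True x 1(2) w in auto)
    next
      case False
      show thesis by (rule that[of "x # u"]) (use hk_eq_delete_right[of x V u E] False 1(2) w in auto)
    qed
    then have v: "length (p @ v @ q) < length w" "set (p @ v @ q) \<subseteq> V" "hk_eq V E w (p @ v @ q)"
      using hk_eq_context[of V E "x # u @ [x]" v p q] 1(2) w by auto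
    from 1(1)[rule_format, OF v(1,2)] obtain w' where w': "set w' \<subseteq> V"
      "hk_eq V E w' (p @ v @ q)" "length w' \<le> length (p @ v @ q)" "reduced E w'" by blast
    have "hk_eq V E w' w" using w'(2) v(3) by (blast intro: hk_eq_trans hk_eq_sym)
    then show ?thesis using w' v(1) by (intro exI[of _ w']) auto
  qed
qed

section \<open>Occurrence bounds and segments of reduced words\<close>

lemma length_filter_mem_eq_sum:
  "finite A \<Longrightarrow> length (filter (\<lambda>z. z \<in> A) w) = (\<Sum>z\<in>A. count_list w z)"
proof (induction w)
  case (Cons a w)
  have "(\<Sum>z\<in>A. count_list (a # w) z) = (\<Sum>z\<in>A. (if a = z then 1 else 0) + count_list w z)"
    by (rule sum.cong) auto
  then show ?case using Cons by (simp add: sum.distrib)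
qed simp

lemma count_list_le_if_no_adjacent:
  assumes "successively (\<lambda>a b. \<not> (a = x \<and> b = x)) l"
  shows "count_list l x \<le> Suc (length (filter (\<lambda>z. z \<noteq> x) l))"
proof -
  \<comment> \<open>Strengthened for the induction: the additional one is due only when the list
    begins with \<open>x\<close>.\<close>
  have "count_list l x \<le> length (filter (\<lambda>z. z \<noteq> x) l) + (if l \<noteq> [] \<and> hd l = x then 1 else 0)"
    using assms by (induction l) (auto simp: successively_Cons split: if_splits)
  then show ?thesis by (simp split: if_splits)
qed

text \<open>In the projection to \<open>x\<close> and its predecessors no two letters
  \<open>x\<close> are neighbours, because a predecessor lies between them.\<close>

lemma reduced_count_le_sum:
  assumes "finite {z. E z x}" "\<not> E x x" "reduced E w"
  shows "count_list w x \<le> Suc (\<Sum>z | E z x. count_list w z)"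
proof -
  let ?P = "\<lambda>z. z = x \<or> E z x"
  have "successively (\<lambda>a b. \<not> (a = x \<and> b = x)) (filter ?P w)"
  proof (rule filter_successivelyI, intro notI)
    fix p a u b q
    assume w: "w = p @ a # u @ b # q" "\<forall>z\<in>set u. \<not> ?P z" and "a = x \<and> b = x"
    then have "w = p @ x # u @ x # q" "x \<notin> set u" by auto
    from reducedD(1)[OF assms(3) this] w(2) show False by auto
  qed
  from count_list_le_if_no_adjacent[OF this]
  have "count_list (filter ?P w) x \<le> Suc (length (filter (\<lambda>z. z \<noteq> x) (filter ?P w)))" .
  moreover have "count_list (filter ?P w) x = count_list w x" by (induction w) auto
  moreover have "filter (\<lambda>z. z \<noteq> x) (filter ?P w) = filter (\<lambda>z. z \<in> {z. E z x}) w"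
    unfolding filter_filter by (rule filter_cong) (use assms(2) in auto)
  ultimately show ?thesis using length_filter_mem_eq_sum[OF assms(1), of w] by simp
qed

text \<open>\<open>paths_to\<close> satisfies with equality the recursion that the counts satisfy as
  an inequality.\<close>

lemma reduced_count_le_paths:
  assumes S: "acyclic_lower_set V E S" "finite V" and w: "reduced E w" and x: "x \<in> S"
  shows "count_list w x \<le> paths_to V E x"
  using S x
proof (induction rule: acyclic_lower_set_induct)
  case (step x)
  have lower: "z \<in> S" if "E z x" for z using S step(1) that by (auto simp: acyclic_lower_set_def)
  have fin: "finite {z. E z x}"
    by (rule finite_subset[OF _ S(2)]) (use lower S(1) in \<open>auto simp: acyclic_lower_set_def\<close>)
  have irr: "\<not> E x x" using S(1) step(1) by (auto simp: acyclic_lower_set_def)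
  have "(\<Sum>z | E z x. count_list w z) \<le> (\<Sum>z | E z x. paths_to V E z)"
    by (rule sum_mono) (use step(2) lower in auto)
  then show ?case
    using reduced_count_le_sum[OF fin irr w] paths_to_rec[OF S step(1)] by simp
qed

text \<open>Empty segments are kept, so there is always one more segment than letters in
  \<open>A\<close>, and \<open>w\<close> can be rebuilt by weaving both together.\<close>

fun segs :: "('v \<Rightarrow> bool) \<Rightarrow> 'v list \<Rightarrow> 'v list list" where
  "segs A [] = [[]]"
| "segs A (x # w) = (if A x then [] # segs A w else (x # hd (segs A w)) # tl (segs A w))"

lemma segs_not_Nil [simp]: "segs A w \<noteq> []"
  by (induction w) auto

lemma length_segs: "length (segs A w) = Suc (length (filter A w))"
  by (induction w) auto

lemma segs_factor: "s \<in> set (segs A w) \<Longrightarrow> \<exists>p q. w = p @ s @ q \<and> (\<forall>z\<in>set s. \<not> A z)"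
proof -
  have "(\<exists>q. w = hd (segs A w) @ q \<and> (\<forall>z\<in>set (hd (segs A w)). \<not> A z)) \<and>
    (\<forall>s\<in>set (tl (segs A w)). \<exists>p q. w = p @ s @ q \<and> (\<forall>z\<in>set s. \<not> A z))"
  proof (induction w)
    case (Cons x w)
    have tl: "\<forall>s\<in>set (tl (segs A w)). \<exists>p q. x # w = p @ s @ q \<and> (\<forall>z\<in>set s. \<not> A z)"
      using Cons.IH by (metis append_Cons)
    obtain q where q: "w = hd (segs A w) @ q" "\<forall>z\<in>set (hd (segs A w)). \<not> A z"
      using Cons.IH by blast
    have hd: "\<exists>p q. x # w = p @ hd (segs A w) @ q \<and> (\<forall>z\<in>set (hd (segs A w)). \<not> A z)"
      by (rule exI[of _ "[x]"], rule exI[of _ q]) (use q in simp)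
    show ?case
    proof (cases "A x")
      case True
      have "set (segs A w) = insert (hd (segs A w)) (set (tl (segs A w)))"
        by (metis list.collapse list.simps(15) segs_not_Nil)
      then show ?thesis using True tl hd by auto
    next
      case False
      then show ?thesis using tl q by (auto intro: exI[of _ q])
    qed
  qed simp
  moreover assume "s \<in> set (segs A w)"
  then have "s = hd (segs A w) \<or> s \<in> set (tl (segs A w))"
    by (metis list.collapse segs_not_Nil set_ConsD)
  ultimately show ?thesis by (metis append_Nil)
qed

lemma segs_weave: "w = hd (segs A w) @ concat (map2 (\<lambda>a s. a # s) (filter A w) (tl (segs A w)))"
proof (induction w)
  case (Cons x w)
  have "segs A w = hd (segs A w) # tl (segs A w)" by simp
  then have "zip (x # filter A w) (segs A w)
      = (x, hd (segs A w)) # zip (filter A w) (tl (segs A w))"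
    by (metis zip_Cons_Cons)
  then show ?case using Cons by auto
qed simp

lemma filter_eq_if_segs_eq:
  assumes "filter A u = filter A w" "map (filter P) (segs A u) = map (filter P) (segs A w)"
  shows "filter P u = filter P w"
proof -
  have weave: "filter P w = hd (map (filter P) (segs A w)) @
    concat (map2 (\<lambda>a s. filter P [a] @ s) (filter A w) (tl (map (filter P) (segs A w))))" for w
  proof -
    have "filter P (concat (map2 (\<lambda>a s. a # s) as ss))
        = concat (map2 (\<lambda>a s. filter P [a] @ s) as (map (filter P) ss))" for as ss
      by (induction as ss rule: list_induct2') auto
    then show ?thesis
      by (subst segs_weave[of w A]) (simp add: hd_map map_tl)
  qed
  show ?thesis by (subst (1 2) weave) (simp only: assms)
qed

text \<open>The window around \<open>2 * m\<close> lets a single number \<open>m\<close> serve all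
  arrows of a cycle at once; bounding each projection separately would leave one free parameter per
  arrow.\<close>

definition alternating_words :: "'v \<Rightarrow> 'v \<Rightarrow> nat \<Rightarrow> nat \<Rightarrow> 'v list set" where
  "alternating_words a b B m =
     {l. set l \<subseteq> {a, b} \<and> distinct_adj l \<and> 2 * m \<le> length l + B \<and> length l \<le> 2 * m + B}"

lemma alternating_eq:
  assumes "length l = length l'" "set l \<subseteq> {a, b}" "set l' \<subseteq> {a, b}"
    "distinct_adj l" "distinct_adj l'" "l \<noteq> [] \<Longrightarrow> hd l = hd l'"
  shows "l = l'"
  using assms
proof (induction l l' rule: list_induct2)
  case (Cons x l y l')
  then have xy: "x = y" by simp
  have "l = l'"
  proof (cases "l = []")
    case False
    then have l': "l' \<noteq> []" using Cons.hyps by auto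
    have "hd l \<in> set l" "hd l' \<in> set l'" using False l' by simp_all
    then have "hd l \<in> {a, b}" "hd l' \<in> {a, b}" using Cons.prems(1,2) by auto
    moreover have "x \<in> {a, b}" "hd l \<noteq> x" "hd l' \<noteq> x"
      using Cons.prems xy False l' by (auto simp: distinct_adj_Cons)
    ultimately have "hd l = hd l'" by auto
    then show ?thesis using Cons.prems Cons.IH by (auto dest: distinct_adj_ConsD)
  qed (use Cons.hyps in auto)
  with xy show ?case by simp
qed simp

text \<open>An alternating word on two letters is determined by its first letter and its length, and
  at most \<open>2 * B + 1\<close> lengths occur.\<close>

lemma card_alternating_words:
  "finite (alternating_words a b B m)" "card (alternating_words a b B m) \<le> 2 * (2 * B + 1)"
proof -
  let ?f = "\<lambda>l. (l = [] \<or> hd l = a, length l)"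
  have inj: "inj_on ?f (alternating_words a b B m)"
  proof (rule inj_onI)
    fix l l' assume l: "l \<in> alternating_words a b B m" "l' \<in> alternating_words a b B m" "?f l = ?f l'"
    show "l = l'"
    proof (rule alternating_eq[of l l' a b])
      assume "l \<noteq> []"
      then have "l' \<noteq> []" using l(3) by auto
      then have "hd l \<in> set l" "hd l' \<in> set l'" using \<open>l \<noteq> []\<close> by simp_all
      then show "hd l = hd l'" using l by (auto simp: alternating_words_def)
    qed (use l in \<open>auto simp: alternating_words_def\<close>)
  qed
  have sub: "?f ` alternating_words a b B m \<subseteq> UNIV \<times> {2 * m - B..2 * m + B}"
    by (auto simp: alternating_words_def)
  show "finite (alternating_words a b B m)"
    by (rule inj_on_finite[OF inj sub]) simp
  have "card (alternating_words a b B m) \<le> card ((UNIV :: bool set) \<times> {2 * m - B..2 * m + B})"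
    by (rule card_inj_on_le[OF inj sub]) simp
  also have "\<dots> \<le> 2 * (2 * B + 1)" by (simp add: card_cartesian_product)
  finally show "card (alternating_words a b B m) \<le> 2 * (2 * B + 1)" .
qed

lemma distinct_adj_count_le:
  assumes "distinct_adj l" "set l \<subseteq> {a, b}" "a \<noteq> b"
  shows "count_list l a \<le> Suc (count_list l b)"
proof -
  have "successively (\<lambda>x y. \<not> (x = a \<and> y = a)) l"
    using assms(1) unfolding distinct_adj_def by (rule successively_mono) auto
  from count_list_le_if_no_adjacent[OF this]
  have "count_list l a \<le> Suc (length (filter (\<lambda>z. z \<noteq> a) l))" .
  also have "filter (\<lambda>z. z \<noteq> a) l = filter ((=) b) l"
    by (rule filter_cong) (use assms(2,3) in auto)
  finally show ?thesis by (simp add: count_list_eq_length_filter)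
qed

section \<open>Upper bound for the growth\<close>

context separated_cycles
begin

definition degree_bound :: "('v \<times> 'v) set \<Rightarrow> nat" where
  "degree_bound C = (\<Sum>x\<in>adj_set V E C. kx V E C x)"

definition hk_degree :: nat where
  "hk_degree = (\<Sum>C\<in>cycles V E. degree_bound C + 1)"

definition seg_code :: "('v \<times> 'v) set \<Rightarrow> 'v list \<Rightarrow> 'v \<times> 'v \<Rightarrow> 'v list" where
  "seg_code C s = restrict (\<lambda>(a, b). filter (\<lambda>z. z = a \<or> z = b) s) C"

text \<open>Letters of different cycles commute, so each cycle is recorded separately, cut only at
  its own neighbours.\<close>

definition word_code :: "'v list \<Rightarrow> 'v list \<times> (('v \<times> 'v) set \<Rightarrow> ('v \<times> 'v \<Rightarrow> 'v list) list)" where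
  "word_code w = (filter (\<lambda>z. z \<notin> cycle_vertices V E) w,
     restrict (\<lambda>C. map (seg_code C) (segs (\<lambda>z. z \<in> adj_set V E C) w)) (cycles V E))"

lemma adj_set_noncycle: "C \<in> cycles V E \<Longrightarrow> x \<in> adj_set V E C \<Longrightarrow> x \<notin> cycle_vertices V E"
  by (erule adj_set_cases) (auto simp: below_def above_def cycle_vertices_def)

lemma finite_adj_set: "finite (adj_set V E C)"
  by (rule finite_subset[OF _ finite_V]) (auto simp: adj_set_def)

text \<open>By \<open>no_chord\<close> an edge joins two non-cycle vertices, is an arrow of a cycle,
  or joins a cycle to one of its neighbours. In each case the code determines the projection to its
  two ends.\<close>

lemma word_code_eq_imp_hk_eq:
  assumes "set u \<subseteq> V" "set w \<subseteq> V" "word_code u = word_code w"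
  shows "hk_eq V E u w"
proof -
  let ?cyc = "cycle_vertices V E"
  have N: "filter (\<lambda>z. z \<notin> ?cyc) u = filter (\<lambda>z. z \<notin> ?cyc) w"
    using assms(3) by (simp add: word_code_def)
  have codes: "map (seg_code C) (segs (\<lambda>z. z \<in> adj_set V E C) u)
      = map (seg_code C) (segs (\<lambda>z. z \<in> adj_set V E C) w)" if "C \<in> cycles V E" for C
    using fun_cong[OF arg_cong[OF assms(3), of snd], of C] that by (simp add: word_code_def)
  have noncyc: "filter P u = filter P w" if "\<And>z. P z \<Longrightarrow> z \<notin> ?cyc" for P
  proof -
    have "filter P v = filter P (filter (\<lambda>z. z \<notin> ?cyc) v)" for v
      unfolding filter_filter by (rule filter_cong) (use that in auto)
    with N show ?thesis by metis
  qed
  have from_code: "filter P u = filter P w"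
    if C: "C \<in> cycles V E"
      and g: "\<And>s. \<forall>z\<in>set s. z \<notin> adj_set V E C \<Longrightarrow> filter P s = g (seg_code C s)" for C P g
  proof (rule filter_eq_if_segs_eq)
    show "filter (\<lambda>z. z \<in> adj_set V E C) u = filter (\<lambda>z. z \<in> adj_set V E C) w"
      by (rule noncyc) (use adj_set_noncycle[OF C] in auto)
    have conv: "map (filter P) (segs (\<lambda>z. z \<in> adj_set V E C) v)
      = map g (map (seg_code C) (segs (\<lambda>z. z \<in> adj_set V E C) v))" for v
      unfolding map_map o_def
      by (rule map_cong[OF refl], rule g) (use segs_factor in metis)
    show "map (filter P) (segs (\<lambda>z. z \<in> adj_set V E C) u)
      = map (filter P) (segs (\<lambda>z. z \<in> adj_set V E C) w)"
      by (simp only: conv codes[OF C])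
  qed
  have arrow: "filter (\<lambda>z. z = a \<or> z = b) u = filter (\<lambda>z. z = a \<or> z = b) w"
    if "C \<in> cycles V E" "(a, b) \<in> C" for C a b
    by (rule from_code[OF that(1), of _ "\<lambda>f. f (a, b)"]) (use that(2) in \<open>simp add: seg_code_def\<close>)
  \<comment> \<open>Within a segment \<open>b\<close> does not occur, so the projection is a power
    of \<open>a\<close>, which can be read off from the code at an arrow
    \<open>(a, c)\<close>.\<close>
  have mixed: "filter (\<lambda>z. z = a \<or> z = b) u = filter (\<lambda>z. z = a \<or> z = b) w"
    if C: "C \<in> cycles V E" and ab: "a \<in> cverts C" "b \<in> adj_set V E C" for C a b
  proof -
    obtain c where c: "(a, c) \<in> C" using arrow_exists(1)[OF C ab(1)] by blast
    show ?thesis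
    proof (rule from_code[OF C, of _ "\<lambda>f. filter (\<lambda>z. z = a) (f (a, c))"])
      fix s :: "'v list" assume s: "\<forall>z\<in>set s. z \<notin> adj_set V E C"
      have "filter (\<lambda>z. z = a) (seg_code C s (a, c)) = filter (\<lambda>z. z = a) s"
        using c by (simp add: seg_code_def) (metis (lifting))
      also have "\<dots> = filter (\<lambda>z. z = a \<or> z = b) s"
        by (rule filter_cong) (use s ab(2) in auto)
      finally show "filter (\<lambda>z. z = a \<or> z = b) s = filter (\<lambda>z. z = a) (seg_code C s (a, c))" ..
    qed
  qed
  have adj: "filter (\<lambda>z. z = a \<or> z = b) u = filter (\<lambda>z. z = a \<or> z = b) w"
    if ab: "E a b \<or> E b a" and a: "a \<in> ?cyc" for a b
  proof -
    obtain C where C: "C \<in> cycles V E" "a \<in> cverts C" using a by (auto simp: cycle_vertices_def)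
    show ?thesis
    proof (cases "b \<in> cverts C")
      case True
      then have "(a, b) \<in> C \<or> (b, a) \<in> C" using ab no_chord C by blast
      then show ?thesis using arrow[OF C(1), of a b] arrow[OF C(1), of b a] by (auto simp: disj_commute)
    next
      case False
      then have "b \<in> adj_set V E C" using ab C edge_in_V by (auto simp: adj_set_def)
      with C show ?thesis by (rule mixed)
    qed
  qed
  show ?thesis
  proof (rule hk_eq_if_same_projections[OF assms(1,2)])
    fix a b assume "E a b"
    then show "filter (\<lambda>z. z = a \<or> z = b) u = filter (\<lambda>z. z = a \<or> z = b) w"
      using adj[of a b] adj[of b a] noncyc[of "\<lambda>z. z = a \<or> z = b"] by (auto simp: disj_commute)
  next
    fix a
    have "filter ((=) a) u = filter ((=) a) w"
    proof (cases "a \<in> ?cyc")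
      case True
      then obtain C c where "C \<in> cycles V E" "(a, c) \<in> C"
        using arrow_exists(1) unfolding cycle_vertices_def by blast
      then have "filter ((=) a) (filter (\<lambda>z. z = a \<or> z = c) u)
          = filter ((=) a) (filter (\<lambda>z. z = a \<or> z = c) w)" using arrow by metis
      moreover have "filter ((=) a) (filter (\<lambda>z. z = a \<or> z = c) v) = filter ((=) a) v" for v
        unfolding filter_filter by (rule filter_cong) auto
      ultimately show ?thesis by simp
    qed (use noncyc[of "(=) a"] in auto)
    then show "count_list u a = count_list w a" by (simp add: count_list_eq_length_filter)
  qed
qed

definition seg_codes :: "('v \<times> 'v) set \<Rightarrow> nat \<Rightarrow> ('v \<times> 'v \<Rightarrow> 'v list) set" where
  "seg_codes C n = (\<Union>m\<le>n. PiE C (\<lambda>(a, b). alternating_words a b (2 * card V) m))"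

text \<open>A segment contains no neighbour of \<open>C\<close>, so a letter that reducedness
  demands between two equal cycle letters lies on \<open>C\<close> itself. Predecessors and
  successors on \<open>C\<close> being unique, the two ends of each arrow alternate. Counts then
  change by at most one per step along \<open>C\<close> and stay within \<open>card V\<close> of
  that of \<open>cs ! 0\<close>; two letters give the width \<open>2 * card V\<close>.\<close>

lemma seg_code_in_seg_codes:
  assumes C: "C \<in> cycles V E" and w: "reduced E w" "set w \<subseteq> V" "w = p @ s @ q"
    and s: "\<forall>z\<in>set s. z \<notin> adj_set V E C"
  shows "seg_code C s \<in> seg_codes C (length w)"
proof -
  have alt: "distinct_adj (filter (\<lambda>z. z = a \<or> z = b) s)" if ab: "(a, b) \<in> C" for a b
    unfolding distinct_adj_def
  proof (rule filter_successivelyI, rule notI)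
    fix p' x u y q'
    assume sp: "s = p' @ x # u @ y # q'" and x: "x = a \<or> x = b"
      and u: "\<forall>z\<in>set u. \<not> (z = a \<or> z = b)" and eq: "x = y"
    have wx: "w = (p @ p') @ x # u @ x # (q' @ q)" "x \<notin> set u"
      using w(3) sp eq x u by auto
    note ab' = arrow_verts[OF C ab]
    have su: "z \<in> cverts C" if "z \<in> set u" "E z x \<or> E x z" for z
    proof -
      have "z \<in> V" "z \<notin> adj_set V E C" "x \<in> cverts C"
        using that(1) s sp w(2,3) x ab' by auto
      then show ?thesis using that(2) by (auto simp: adj_set_def)
    qed
    \<comment> \<open>Two letters \<open>b\<close> enclose an in-neighbour of \<open>b\<close>,
      which must be \<open>a\<close>; two letters \<open>a\<close> enclose an out-neighbour of
      \<open>a\<close>, which must be \<open>b\<close>.\<close>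
    show False
    proof (cases "x = b")
      case True
      obtain z where z: "z \<in> set u" "E z x" using reducedD(1)[OF w(1) wx] by blast
      then have "(z, b) \<in> C" using no_chord[OF C su] True ab' by blast
      then have "z = a" using arrow_unique(1)[OF C _ ab] by blast
      then show False using u z by auto
    next
      case False
      obtain z where z: "z \<in> set u" "E x z" using reducedD(2)[OF w(1) wx] by blast
      then have "(a, z) \<in> C" using no_chord[OF C _ su] False x ab' by blast
      then have "z = b" using arrow_unique(2)[OF C _ ab] by blast
      then show False using u z by auto
    qed
  qed
  have cnt_filter: "count_list (filter (\<lambda>z. z = a \<or> z = b) s) a = count_list s a"
    "count_list (filter (\<lambda>z. z = a \<or> z = b) s) b = count_list s b" for a b
    by (induction s) auto
  have step: "count_list s a \<le> Suc (count_list s b)" "count_list s b \<le> Suc (count_list s a)"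
    if ab: "(a, b) \<in> C" for a b
  proof -
    have "a \<noteq> b" using arrow_verts(3)[OF C ab] edge_irrefl by auto
    then show "count_list s a \<le> Suc (count_list s b)" "count_list s b \<le> Suc (count_list s a)"
      using distinct_adj_count_le[OF alt[OF ab], of a b] distinct_adj_count_le[OF alt[OF ab], of b a]
        cnt_filter[of a b] by auto
  qed
  obtain cs where cs: "cycle_list V E cs" "C = cycle_arrows cs" "cverts C = set cs"
    using C by (rule cycleE)
  have len: "length cs > 0" "length cs \<le> card V"
  proof -
    show "length cs \<le> card V"
      using cs(1) card_mono[OF finite_V, of "set cs"] by (simp add: cycle_list_def distinct_card)
  qed (use cs(1) in \<open>auto simp: cycle_list_def\<close>)
  have near: "count_list s (cs ! i) \<le> count_list s (cs ! 0) + i \<and>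
    count_list s (cs ! 0) \<le> count_list s (cs ! i) + i" if "i < length cs" for i
    using that
  proof (induction i)
    case (Suc i)
    then have "(cs ! i, cs ! Suc i) \<in> C" unfolding cs cycle_arrows_iff by (intro exI[of _ i]) simp
    from step[OF this] Suc show ?case by simp
  qed simp
  let ?m = "count_list s (cs ! 0)"
  have near': "count_list s a \<le> ?m + card V \<and> ?m \<le> count_list s a + card V"
    if a: "a \<in> cverts C" for a
  proof -
    obtain i where "i < length cs" "a = cs ! i" using a cs(3) by (auto simp: in_set_conv_nth)
    with near[of i] len(2) show ?thesis by auto
  qed
  have "?m \<le> length w" using count_le_length[of s "cs ! 0"] w(3) by simp
  moreover have "filter (\<lambda>z. z = a \<or> z = b) s \<in> alternating_words a b (2 * card V) ?m"
    if ab: "(a, b) \<in> C" for a b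
  proof -
    have "a \<noteq> b" using arrow_verts(3)[OF C ab] edge_irrefl by auto
    then have "length (filter (\<lambda>z. z = a \<or> z = b) s) = count_list s a + count_list s b"
      using length_filter_mem_eq_sum[of "{a, b}" s] by simp
    then show ?thesis
      using near'[of a] near'[of b] arrow_verts[OF C ab] alt[OF ab]
      by (auto simp: alternating_words_def)
  qed
  then have "seg_code C s \<in> PiE C (\<lambda>(a, b). alternating_words a b (2 * card V) ?m)"
    by (auto simp: seg_code_def)
  ultimately show ?thesis unfolding seg_codes_def by blast
qed

text \<open>For fixed \<open>m\<close> the number of codes is bounded independently of
  \<open>n\<close>; the factor \<open>n + 1\<close> is the choice of \<open>m\<close>.\<close>

lemma card_seg_codes:
  assumes C: "C \<in> cycles V E"
  shows "finite (seg_codes C n)"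
    "card (seg_codes C n) \<le> (2 * (2 * (2 * card V) + 1)) ^ card C * (n + 1)"
proof -
  let ?q = "2 * (2 * (2 * card V) + 1)"
  let ?A = "\<lambda>m (a, b). alternating_words a b (2 * card V) m"
  have fin: "finite (PiE C (?A m))" for m
    by (rule finite_PiE) (use finite_cycles(2)[OF C] card_alternating_words(1) in auto)
  then show "finite (seg_codes C n)" by (auto simp: seg_codes_def)
  have "card (PiE C (?A m)) \<le> ?q ^ card C" for m
  proof -
    have "card (PiE C (?A m)) = (\<Prod>c\<in>C. card (?A m c))"
      by (rule card_PiE) (rule finite_cycles(2)[OF C])
    also have "\<dots> \<le> (\<Prod>c\<in>C. ?q)"
    proof (rule prod_mono)
      fix c assume "c \<in> C"
      obtain a b where "c = (a, b)" by fastforce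
      then show "0 \<le> card (?A m c) \<and> card (?A m c) \<le> ?q"
        using card_alternating_words(2)[of a b "2 * card V" m] by (simp only: case_prod_conv) simp
    qed
    finally show ?thesis by simp
  qed
  then have "(\<Sum>m\<le>n. card (PiE C (?A m))) \<le> (\<Sum>m\<le>n. ?q ^ card C)" by (intro sum_mono)
  moreover have "card (seg_codes C n) \<le> (\<Sum>m\<le>n. card (PiE C (?A m)))"
    unfolding seg_codes_def by (rule card_UN_le) simp
  ultimately show "card (seg_codes C n) \<le> ?q ^ card C * (n + 1)"
    by (simp add: mult.commute)
qed

lemma reduced_count_le:
  assumes "reduced E w" "x \<in> V - cycle_vertices V E"
  shows "count_list w x \<le> (if x \<in> below then paths_to V E x else paths_to V (\<lambda>a b. E b a) x)"
proof (cases "x \<in> below")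
  case True
  then show ?thesis using reduced_count_le_paths[OF below_lower finite_V assms(1)] by simp
next
  case False
  then have "x \<in> above" using assms(2) below_above by blast
  then show ?thesis
    using reduced_count_le_paths[OF above_lower finite_V reduced_rev[OF assms(1)]] False by simp
qed

lemma reduced_adj_length:
  assumes "C \<in> cycles V E" "reduced E w"
  shows "length (filter (\<lambda>z. z \<in> adj_set V E C) w) \<le> degree_bound C"
proof -
  have "count_list w x \<le> kx V E C x" if x: "x \<in> adj_set V E C" for x
  proof -
    have "x \<in> V - cycle_vertices V E"
      using adj_set_noncycle[OF assms(1) x] x by (auto simp: adj_set_def)
    from reduced_count_le[OF assms(2) this] show ?thesis
      using adj_set_cases[OF assms(1) x] below_above(1) by (metis disjoint_iff)
  qed
  then show ?thesis
    unfolding degree_bound_def length_filter_mem_eq_sum[OF finite_adj_set] by (intro sum_mono)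
qed

definition word_codes :: "nat \<Rightarrow> ('v list \<times> (('v \<times> 'v) set \<Rightarrow> ('v \<times> 'v \<Rightarrow> 'v list) list)) set" where
  "word_codes n = {l. set l \<subseteq> V \<and> length l \<le> (\<Sum>x\<in>V - cycle_vertices V E.
       if x \<in> below then paths_to V E x else paths_to V (\<lambda>a b. E b a) x)} \<times>
     PiE (cycles V E) (\<lambda>C. {l. set l \<subseteq> seg_codes C n \<and> length l \<le> degree_bound C + 1})"

lemma word_code_in_word_codes:
  assumes "reduced E w" "set w \<subseteq> V" "length w \<le> n"
  shows "word_code w \<in> word_codes n"
proof -
  have "filter (\<lambda>z. z \<notin> cycle_vertices V E) w = filter (\<lambda>z. z \<in> V - cycle_vertices V E) w"
    by (rule filter_cong) (use assms(2) in auto)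
  moreover have "length (filter (\<lambda>z. z \<in> V - cycle_vertices V E) w) \<le> (\<Sum>x\<in>V - cycle_vertices V E.
       if x \<in> below then paths_to V E x else paths_to V (\<lambda>a b. E b a) x)"
    by (subst length_filter_mem_eq_sum)
      (use finite_V reduced_count_le[OF assms(1)] in \<open>auto intro!: sum_mono\<close>)
  moreover have "seg_code C s \<in> seg_codes C n"
    if C: "C \<in> cycles V E" and s: "s \<in> set (segs (\<lambda>z. z \<in> adj_set V E C) w)" for C s
  proof -
    obtain p q where "w = p @ s @ q" "\<forall>z\<in>set s. z \<notin> adj_set V E C"
      using segs_factor[OF s] by blast
    from seg_code_in_seg_codes[OF C assms(1,2) this] show ?thesis
      using assms(3) by (force simp: seg_codes_def)
  qed
  ultimately show ?thesis
    using assms(2) reduced_adj_length[OF _ assms(1)]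
    by (auto simp: word_code_def word_codes_def length_segs)
qed

text \<open>The non-cycle part takes boundedly many values, and a cycle contributes at most
  \<open>degree_bound C + 1\<close> segments with linearly many codes each.\<close>

lemma card_word_codes: "\<exists>c. \<forall>n. finite (word_codes n) \<and> card (word_codes n) \<le> c * (n + 1) ^ hk_degree"
proof -
  define M where "M = (\<Sum>x\<in>V - cycle_vertices V E.
       if x \<in> below then paths_to V E x else paths_to V (\<lambda>a b. E b a) x)"
  define q where "q C = (2 * (2 * (2 * card V) + 1)) ^ card C" for C :: "('v \<times> 'v) set"
  \<comment> \<open>\<open>degree_bound C + 2\<close> is the number of possible list lengths, from 0
    to \<open>degree_bound C + 1\<close>; each is estimated by the largest power.\<close>
  define c where "c = card {l. set l \<subseteq> V \<and> length l \<le> M} *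
    (\<Prod>C\<in>cycles V E. (degree_bound C + 2) * q C ^ (degree_bound C + 1))"
  have "finite (word_codes n) \<and> card (word_codes n) \<le> c * (n + 1) ^ hk_degree" for n
  proof -
    define L where "L = (\<lambda>C. {l. set l \<subseteq> seg_codes C n \<and> length l \<le> degree_bound C + 1})"
    have codes: "word_codes n = {l. set l \<subseteq> V \<and> length l \<le> M} \<times> PiE (cycles V E) L"
      unfolding word_codes_def M_def L_def ..
    have finL: "finite (L C)" if "C \<in> cycles V E" for C
      unfolding L_def by (rule finite_lists_length_le[OF card_seg_codes(1)[OF that]])
    have "card (L C) \<le> ((degree_bound C + 2) * q C ^ (degree_bound C + 1)) * (n + 1) ^ (degree_bound C + 1)"
      if C: "C \<in> cycles V E" for C
    proof -
      have "q C \<ge> 1" by (simp add: q_def)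
      then have pos: "1 \<le> q C * (n + 1)" by simp
      have "card (L C) = (\<Sum>i\<le>degree_bound C + 1. card (seg_codes C n) ^ i)"
        unfolding L_def by (rule card_lists_length_le[OF card_seg_codes(1)[OF C]])
      also have "\<dots> \<le> (\<Sum>i\<le>degree_bound C + 1. (q C * (n + 1)) ^ (degree_bound C + 1))"
      proof (rule sum_mono)
        fix i assume "i \<in> {..degree_bound C + 1}"
        then have "(q C * (n + 1)) ^ i \<le> (q C * (n + 1)) ^ (degree_bound C + 1)"
          using pos by (intro power_increasing) auto
        moreover have "card (seg_codes C n) ^ i \<le> (q C * (n + 1)) ^ i"
          using card_seg_codes(2)[OF C] unfolding q_def by (intro power_mono) auto
        ultimately show "card (seg_codes C n) ^ i \<le> (q C * (n + 1)) ^ (degree_bound C + 1)" by simp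
      qed
      also have "\<dots> = ((degree_bound C + 2) * q C ^ (degree_bound C + 1)) * (n + 1) ^ (degree_bound C + 1)"
        by (simp only: sum_constant card_atMost power_mult_distrib of_nat_id) (simp add: algebra_simps)
      finally show ?thesis .
    qed
    then have "(\<Prod>C\<in>cycles V E. card (L C)) \<le> (\<Prod>C\<in>cycles V E.
      ((degree_bound C + 2) * q C ^ (degree_bound C + 1)) * (n + 1) ^ (degree_bound C + 1))"
      by (intro prod_mono) auto
    also have "\<dots> = (\<Prod>C\<in>cycles V E. (degree_bound C + 2) * q C ^ (degree_bound C + 1)) * (n + 1) ^ hk_degree"
      unfolding hk_degree_def power_sum prod.distrib ..
    finally have "card (word_codes n) \<le> c * (n + 1) ^ hk_degree"
      unfolding codes card_cartesian_product card_PiE[OF finite_cycles(1)] c_def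
      by (simp only: mult.assoc mult_le_mono2)
    moreover have "finite (word_codes n)"
      unfolding codes using finL by (intro finite_cartesian_product finite_PiE finite_cycles
          finite_lists_length_le finite_V) auto
    ultimately show ?thesis by simp
  qed
  then show ?thesis by blast
qed

lemma hk_class_eq: "hk_eq V E u w \<Longrightarrow> hk_class V E u = hk_class V E w"
  unfolding hk_class_def by (auto intro: hk_eq_trans hk_eq_sym)

definition hk_ball :: "nat \<Rightarrow> 'v list set set" where
  "hk_ball n = hk_class V E ` {w. set w \<subseteq> V \<and> length w \<le> n}"

text \<open>The codes map onto the ball: a code is sent to the class of some reduced word having it,
  and by \<open>word_code_eq_imp_hk_eq\<close> the choice does not matter.\<close>

lemma card_hk_ball_le: "\<exists>c. \<forall>n. card (hk_ball n) \<le> c * (n + 1) ^ hk_degree"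
proof -
  obtain c where c: "\<And>n. finite (word_codes n)" "\<And>n. card (word_codes n) \<le> c * (n + 1) ^ hk_degree"
    using card_word_codes by blast
  have "card (hk_ball n) \<le> c * (n + 1) ^ hk_degree" for n
  proof -
    define R where "R = {w. set w \<subseteq> V \<and> length w \<le> n \<and> reduced E w}"
    have "hk_ball n \<subseteq> hk_class V E ` R"
    proof
      fix x assume "x \<in> hk_ball n"
      then obtain w where w: "x = hk_class V E w" "set w \<subseteq> V" "length w \<le> n"
        by (auto simp: hk_ball_def)
      obtain w' where w': "set w' \<subseteq> V" "hk_eq V E w' w" "length w' \<le> length w" "reduced E w'"
        using reduced_exists[OF w(2)] by blast
      then show "x \<in> hk_class V E ` R"
        using w hk_class_eq[OF w'(2)] by (auto simp: R_def intro!: image_eqI[of _ _ w'])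
    qed
    also have "hk_class V E ` R \<subseteq> (\<lambda>x. hk_class V E (inv_into R word_code x)) ` word_codes n"
    proof
      fix x assume "x \<in> hk_class V E ` R"
      then obtain w where w: "x = hk_class V E w" "w \<in> R" by blast
      let ?v = "inv_into R word_code (word_code w)"
      have "?v \<in> R" "word_code ?v = word_code w"
        using w(2) by (auto intro: inv_into_into f_inv_into_f)
      then have "x = hk_class V E ?v"
        using w by (auto simp: R_def intro!: hk_class_eq word_code_eq_imp_hk_eq)
      then show "x \<in> (\<lambda>x. hk_class V E (inv_into R word_code x)) ` word_codes n"
        using word_code_in_word_codes[of w n] w(2) by (auto simp: R_def)
    qed
    finally have "card (hk_ball n) \<le> card (word_codes n)"
      using surj_card_le[OF c(1)] by blast
    with c(2) show ?thesis using le_trans by blast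
  qed
  then show ?thesis by blast
qed

end

section \<open>Lower bound for the growth\<close>

lemma set_concat_replicate_subset: "set (concat (replicate n xs)) \<subseteq> set xs"
  by (induction n) auto

lemma count_concat_replicate: "count_list (concat (replicate n xs)) x = n * count_list xs x"
  by (induction n) auto

lemma filter_concat_replicate: "filter P (concat (replicate n xs)) = concat (replicate n (filter P xs))"
  by (induction n) auto

lemma count_list_distinct: "distinct xs \<Longrightarrow> x \<in> set xs \<Longrightarrow> count_list xs x = 1"
  by (induction xs) auto

lemma length_concat_replicate: "length (concat (replicate n xs)) = n * length xs"
  by (induction n) auto

lemma concat_replicate_add:
  "concat (replicate (m + n) xs) = concat (replicate m xs) @ concat (replicate n xs)"
  by (simp add: replicate_add)

lemma concat_replicate_ends:
  assumes "n \<ge> 1" "xs \<noteq> []"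
  shows "hd (concat (replicate n xs)) = hd xs" "last (concat (replicate n xs)) = last xs"
    "concat (replicate n xs) \<noteq> []"
proof -
  obtain m where m: "n = Suc m" using assms(1) by (cases n) auto
  show "hd (concat (replicate n xs)) = hd xs" "concat (replicate n xs) \<noteq> []" using m assms by auto
  have "concat (replicate n xs) = concat (replicate m xs) @ xs"
    using concat_replicate_add[of m 1 xs] m by simp
  then show "last (concat (replicate n xs)) = last xs" using assms by simp
qed

context separated_cycles
begin

definition cycle_word :: "('v \<times> 'v) set \<Rightarrow> 'v list" where
  "cycle_word C = (SOME cs. cycle_list V E cs \<and> C = cycle_arrows cs)"

lemma cycle_word:
  assumes "C \<in> cycles V E"
  shows "cycle_list V E (cycle_word C)" "C = cycle_arrows (cycle_word C)"
    "set (cycle_word C) = cverts C" "distinct (cycle_word C)" "cycle_word C \<noteq> []"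
proof -
  have "\<exists>cs. cycle_list V E cs \<and> C = cycle_arrows cs" using assms by (auto simp: cycles_def)
  then have *: "cycle_list V E (cycle_word C) \<and> C = cycle_arrows (cycle_word C)"
    unfolding cycle_word_def by (rule someI_ex)
  then show "cycle_list V E (cycle_word C)" "C = cycle_arrows (cycle_word C)" by auto
  show "set (cycle_word C) = cverts C" using * cverts_cycle_arrows by metis
  show "distinct (cycle_word C)" "cycle_word C \<noteq> []" using * by (auto simp: cycle_list_def)
qed

lemma successively_cycle_power:
  assumes C: "C \<in> cycles V E"
  shows "successively (\<lambda>a b. (a, b) \<in> C) (concat (replicate n (cycle_word C)))"
proof (induction n)
  case (Suc n)
  let ?cs = "cycle_word C"
  have len: "length ?cs > 0" using cycle_word(5)[OF C] by simp
  have "(?cs ! i, ?cs ! (Suc i mod length ?cs)) \<in> C" if "i < length ?cs" for i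
    by (subst cycle_word(2)[OF C]) (use that in \<open>auto simp: cycle_arrows_iff\<close>)
  note arrow = this
  have "successively (\<lambda>a b. (a, b) \<in> C) ?cs"
    unfolding successively_conv_nth using arrow by (metis Suc_lessD mod_less)
  moreover have "(last ?cs, hd ?cs) \<in> C"
    using arrow[of "length ?cs - 1"] len by (simp add: last_conv_nth hd_conv_nth)
  moreover have "concat (replicate n ?cs) = [] \<or> hd (concat (replicate n ?cs)) = hd ?cs"
    using concat_replicate_ends(1)[of n ?cs] cycle_word(5)[OF C] by (cases n) auto
  ultimately show ?case using Suc by (auto simp: successively_append_iff)
qed simp

text \<open>The counter runs along \<open>C\<close> with the cycle predecessor as \<open>pr\<close>.
  Positive powers end in the same letter, so it is read at the same vertex for both words. The case
  \<open>r = 0\<close> counts all letters \<open>c\<close>.\<close>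

lemma count_invariant_below:
  assumes C: "C \<in> cycles V E" and c: "c \<in> cverts C"
    and z: "r = 0 \<or> z \<in> below \<and> E z c" and eq: "hk_eq V E w w'"
    and tight: "tight E (filter (\<lambda>x. x \<in> below) w)" "tight E (filter (\<lambda>x. x \<in> below) w')"
    and cyc: "filter (\<lambda>x. x \<in> cverts C) w = concat (replicate n (cycle_word C))" "n \<ge> 1"
      "filter (\<lambda>x. x \<in> cverts C) w' = concat (replicate n' (cycle_word C))" "n' \<ge> 1"
  shows "occ_after z r c w = occ_after z r c w'"
proof (rule occ_after_invariant[where S = below and K = "cverts C" and pr = "\<lambda>b. THE a. (a, b) \<in> C"])
  have pr: "(THE a. (a, b) \<in> C) = a" if "(a, b) \<in> C" for a b
    using that arrow_unique(1)[OF C] by blast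
  show "cverts C \<inter> below = {}" using below_above C by (auto simp: cycle_vertices_def)
  show "E (THE a. (a, v) \<in> C) v \<and> (THE a. (a, v) \<in> C) \<in> cverts C" if v: "v \<in> cverts C" for v
  proof -
    obtain a where "(a, v) \<in> C" using arrow_exists(2)[OF C v] by blast
    then show ?thesis using pr arrow_verts[OF C] by auto
  qed
  show "successively (\<lambda>a b. a = (THE a. (a, b) \<in> C)) (filter (\<lambda>x. x \<in> cverts C) w)"
    "successively (\<lambda>a b. a = (THE a. (a, b) \<in> C)) (filter (\<lambda>x. x \<in> cverts C) w')"
    unfolding cyc by (rule successively_mono[OF successively_cycle_power[OF C]], use pr in auto)+
  show "filter (\<lambda>x. x \<in> cverts C) w \<noteq> []" "filter (\<lambda>x. x \<in> cverts C) w' \<noteq> []"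
    "last (filter (\<lambda>x. x \<in> cverts C) w) = last (filter (\<lambda>x. x \<in> cverts C) w')"
    unfolding cyc using concat_replicate_ends(2,3)[OF _ cycle_word(5)[OF C]] cyc(2,4) by auto
  show "z \<in> below" if "x \<in> below" "E z x" for x z
    using below_lower that by (auto simp: acyclic_lower_set_def)
qed (use graph c z eq tight in auto)

text \<open>The mirror image in the opposite graph: \<open>pr\<close> is now the successor on
  \<open>C\<close>, and letters \<open>c\<close> to the left of an occurrence of \<open>z\<close>
  are counted.\<close>

lemma count_invariant_above:
  assumes C: "C \<in> cycles V E" and c: "c \<in> cverts C"
    and z: "z \<in> above \<and> E c z" and eq: "hk_eq V E w w'"
    and tight: "tight (\<lambda>a b. E b a) (filter (\<lambda>x. x \<in> above) (rev w))"
      "tight (\<lambda>a b. E b a) (filter (\<lambda>x. x \<in> above) (rev w'))"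
    and cyc: "filter (\<lambda>x. x \<in> cverts C) w = concat (replicate n (cycle_word C))" "n \<ge> 1"
      "filter (\<lambda>x. x \<in> cverts C) w' = concat (replicate n' (cycle_word C))" "n' \<ge> 1"
  shows "occ_after z r c (rev w) = occ_after z r c (rev w')"
proof (rule occ_after_invariant[where S = above and K = "cverts C" and pr = "\<lambda>b. THE a. (b, a) \<in> C"
      and E = "\<lambda>a b. E b a"])
  have pr: "(THE a. (b, a) \<in> C) = a" if "(b, a) \<in> C" for a b
    using that arrow_unique(2)[OF C] by blast
  show "cverts C \<inter> above = {}" using below_above C by (auto simp: cycle_vertices_def)
  show "E v (THE a. (v, a) \<in> C) \<and> (THE a. (v, a) \<in> C) \<in> cverts C" if v: "v \<in> cverts C" for v
  proof -
    obtain a where "(v, a) \<in> C" using arrow_exists(1)[OF C v] by blast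
    then show ?thesis using pr arrow_verts[OF C] by auto
  qed
  show "successively (\<lambda>a b. a = (THE a. (b, a) \<in> C)) (filter (\<lambda>x. x \<in> cverts C) (rev w))"
    "successively (\<lambda>a b. a = (THE a. (b, a) \<in> C)) (filter (\<lambda>x. x \<in> cverts C) (rev w'))"
    unfolding rev_filter[symmetric] cyc successively_rev
    by (rule successively_mono[OF successively_cycle_power[OF C]], use pr in auto)+
  show "filter (\<lambda>x. x \<in> cverts C) (rev w) \<noteq> []" "filter (\<lambda>x. x \<in> cverts C) (rev w') \<noteq> []"
    "last (filter (\<lambda>x. x \<in> cverts C) (rev w)) = last (filter (\<lambda>x. x \<in> cverts C) (rev w'))"
    unfolding rev_filter[symmetric] cyc
    using concat_replicate_ends(1,3)[OF _ cycle_word(5)[OF C]] cyc(2,4)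
    by (auto simp: last_rev simp del: rev_concat)
  show "z \<in> above" if "x \<in> above" "E x z" for x z
    using above_lower that by (auto simp: acyclic_lower_set_def)
  show "hk_eq V (\<lambda>a b. E b a) (rev w) (rev w')" by (rule hk_eq_rev[OF eq])
qed (use graph_converse c z tight in auto)

text \<open>A tight word in \<open>below\<close> is followed by the reverse of a tight word in
  \<open>above\<close> for the opposite graph. Every neighbour of a cycle then attains its bound
  \<open>kx\<close>, so the skeleton has as many cutting letters as a reduced word can have.\<close>

lemma skeleton_exists:
  obtains S where "set S \<subseteq> below \<union> above" "tight E (filter (\<lambda>x. x \<in> below) S)"
    "tight (\<lambda>a b. E b a) (filter (\<lambda>x. x \<in> above) (rev S))"
    "\<And>C. C \<in> cycles V E \<Longrightarrow> length (filter (\<lambda>x. x \<in> adj_set V E C) S) = degree_bound C"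
proof -
  obtain u where u: "set u \<subseteq> below" "tight E u" "\<And>x. x \<in> below \<Longrightarrow> count_list u x = paths_to V E x"
    using tight_word_exists[OF below_lower finite_V] by metis
  obtain v where v: "set v \<subseteq> above" "tight (\<lambda>a b. E b a) v"
    "\<And>x. x \<in> above \<Longrightarrow> count_list v x = paths_to V (\<lambda>a b. E b a) x"
    using tight_word_exists[OF above_lower finite_V] by metis
  have f: "filter (\<lambda>x. x \<in> below) u = u" "filter (\<lambda>x. x \<in> above) u = []"
    "filter (\<lambda>x. x \<in> above) v = v" "filter (\<lambda>x. x \<in> below) v = []"
    using u(1) v(1) below_above(1) by (auto simp: filter_id_conv filter_empty_conv)
  let ?S = "u @ rev v"
  show thesis
  proof (rule that[of ?S])
    show "set ?S \<subseteq> below \<union> above" using u v by auto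
    show "tight E (filter (\<lambda>x. x \<in> below) ?S)"
      using u f by (simp add: rev_filter[symmetric])
    show "tight (\<lambda>a b. E b a) (filter (\<lambda>x. x \<in> above) (rev ?S))"
      using v f by (simp add: rev_filter[symmetric])
    fix C assume C: "C \<in> cycles V E"
    have "count_list ?S x = kx V E C x" if x: "x \<in> adj_set V E C" for x
      using C x
    proof (cases rule: adj_set_cases)
      case below
      then have "x \<notin> set v" using v(1) below_above(1) by auto
      then show ?thesis using below u by simp
    next
      case above
      then have "x \<notin> set u" using u(1) below_above(1) by auto
      then show ?thesis using above v by simp
    qed
    then show "length (filter (\<lambda>x. x \<in> adj_set V E C) ?S) = degree_bound C"
      unfolding degree_bound_def length_filter_mem_eq_sum[OF finite_adj_set] by (intro sum.cong) auto
  qed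
qed

section \<open>Words with prescribed cycle exponents\<close>

definition cycle_enum :: "('v \<times> 'v) set list" where
  "cycle_enum = (SOME l. set l = cycles V E \<and> distinct l)"

lemma cycle_enum: "set cycle_enum = cycles V E" "distinct cycle_enum"
proof -
  have "\<exists>l. set l = cycles V E \<and> distinct l" using finite_distinct_list[OF finite_cycles(1)] .
  then have "set cycle_enum = cycles V E \<and> distinct cycle_enum"
    unfolding cycle_enum_def by (rule someI_ex)
  then show "set cycle_enum = cycles V E" "distinct cycle_enum" by auto
qed

definition block :: "(('v \<times> 'v) set \<Rightarrow> nat) \<Rightarrow> 'v list" where
  "block e = concat (map (\<lambda>C. concat (replicate (e C) (cycle_word C))) cycle_enum)"

lemma set_block: "set (block e) \<subseteq> cycle_vertices V E"
  using set_concat_replicate_subset cycle_word(3) cycle_enum(1)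
  unfolding block_def cycle_vertices_def by fastforce

lemma filter_block:
  assumes C: "C \<in> cycles V E"
  shows "filter (\<lambda>x. x \<in> cverts C) (block e) = concat (replicate (e C) (cycle_word C))"
proof -
  have "filter (\<lambda>x. x \<in> cverts C) (concat (map (\<lambda>C. concat (replicate (e C) (cycle_word C))) l))
      = (if C \<in> set l then concat (replicate (e C) (cycle_word C)) else [])"
    if "set l \<subseteq> cycles V E" "distinct l" for l
    using that
  proof (induction l)
    case (Cons D l)
    have "filter (\<lambda>x. x \<in> cverts C) (cycle_word D) = (if D = C then cycle_word C else [])"
      using connected_cycles_eq[OF C, of D] cycle_word(3)[of D] Cons.prems
      by (auto simp: filter_id_conv filter_empty_conv)
    moreover have "concat (replicate (e D) []) = []" by (induction "e D") auto
    ultimately show ?case using Cons by (auto simp: filter_concat_replicate)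
  qed simp
  from this[of cycle_enum] show ?thesis using cycle_enum C by (simp add: block_def)
qed

text \<open>Exponents with index 0 stand before the skeleton, those with index \<open>Suc k\<close>
  behind its letter \<open>S ! k\<close>.\<close>

primrec family_word :: "'v list \<Rightarrow> (nat \<Rightarrow> ('v \<times> 'v) set \<Rightarrow> nat) \<Rightarrow> nat \<Rightarrow> 'v list" where
  "family_word S e 0 = block (e 0)"
| "family_word S e (Suc k) = family_word S e k @ S ! k # block (e (Suc k))"

lemma filter_family_word_noncycle:
  assumes "\<And>z. P z \<Longrightarrow> z \<notin> cycle_vertices V E" "k \<le> length S"
  shows "filter P (family_word S e k) = filter P (take k S)"
proof -
  have b: "filter P (block e) = []" for e
    using set_block assms(1) by (fastforce simp: filter_empty_conv)
  from assms(2) show ?thesis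
    by (induction k) (auto simp: b take_Suc_conv_app_nth)
qed

lemma filter_family_word_cycle:
  assumes C: "C \<in> cycles V E" and S: "set S \<inter> cycle_vertices V E = {}" "k \<le> length S"
  shows "filter (\<lambda>x. x \<in> cverts C) (family_word S e k)
    = concat (replicate (\<Sum>i\<le>k. e i C) (cycle_word C))"
  using S(2)
proof (induction k)
  case (Suc k)
  have "S ! k \<in> set S" using Suc.prems by simp
  then have "S ! k \<notin> cverts C" using S(1) C by (auto simp: cycle_vertices_def)
  then show ?case using Suc by (simp add: filter_block[OF C] concat_replicate_add)
qed (simp add: filter_block[OF C])

lemma count_family_word_cycle:
  assumes "C \<in> cycles V E" "set S \<inter> cycle_vertices V E = {}" "k \<le> length S" "c \<in> cverts C"
  shows "count_list (family_word S e k) c = (\<Sum>i\<le>k. e i C)"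
proof -
  have "count_list (family_word S e k) c
      = count_list (filter (\<lambda>x. x \<in> cverts C) (family_word S e k)) c"
    using assms(4) by (simp add: count_list_eq_length_filter) (metis (lifting))
  also have "\<dots> = (\<Sum>i\<le>k. e i C) * count_list (cycle_word C) c"
    unfolding filter_family_word_cycle[OF assms(1-3)] by (rule count_concat_replicate)
  also have "count_list (cycle_word C) c = 1"
    using cycle_word(3,4)[OF assms(1)] assms(4) by (simp add: count_list_distinct)
  finally show ?thesis by simp
qed

lemma family_word_split:
  assumes "k < m"
  shows "\<exists>post. family_word S e m = family_word S e k @ S ! k # post"
  using assms
proof (induction m)
  case (Suc m)
  show ?case
  proof (cases "k = m")
    case False
    then show ?thesis using Suc by auto
  qed auto
qed simp

text \<open>What the invariants give are partial sums of the exponents of \<open>C\<close>. Up to a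
  neighbour in \<open>above\<close> the sum is obtained directly; for a neighbour in
  \<open>below\<close> the part behind it is obtained and subtracted from the total. Positivity at
  index 0 makes \<open>C\<close> occur, so that its counter ends at a known letter.\<close>

lemma family_word_inj:
  assumes S: "set S \<subseteq> below \<union> above" "tight E (filter (\<lambda>x. x \<in> below) S)"
      "tight (\<lambda>a b. E b a) (filter (\<lambda>x. x \<in> above) (rev S))"
    and C: "C \<in> cycles V E"
    and pos: "e 0 C \<ge> 1" "e' 0 C \<ge> 1"
    and supp: "\<And>k. k < length S \<Longrightarrow> S ! k \<notin> adj_set V E C \<Longrightarrow> e (Suc k) C = 0 \<and> e' (Suc k) C = 0"
    and eq: "hk_eq V E (family_word S e (length S)) (family_word S e' (length S))"
    and i: "i \<le> length S"
  shows "e i C = e' i C"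
proof -
  let ?w = "family_word S e (length S)" and ?w' = "family_word S e' (length S)"
  let ?P = "\<lambda>e k. \<Sum>i\<le>k. e i C"
  have S': "set S \<inter> cycle_vertices V E = {}" using S(1) below_above by blast
  have Sbelow: "filter (\<lambda>x. x \<in> below) (family_word S e (length S)) = filter (\<lambda>x. x \<in> below) S" for e
    using filter_family_word_noncycle[of "\<lambda>x. x \<in> below" "length S" S e] below_above by auto
  have Sabove: "filter (\<lambda>x. x \<in> above) (rev (family_word S e (length S))) = filter (\<lambda>x. x \<in> above) (rev S)" for e
    unfolding rev_filter[symmetric]
    using filter_family_word_noncycle[of "\<lambda>x. x \<in> above" "length S" S e] below_above by auto
  have count_non: "count_list (family_word S e k) z = count_list (take k S) z"
    if "k \<le> length S" "z \<notin> cycle_vertices V E" for e k z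
    unfolding count_list_eq_length_filter
    by (subst filter_family_word_noncycle) (use that in auto)
  note cyc = filter_family_word_cycle[OF C S' order_refl]
  have pos': "?P e (length S) \<ge> 1" "?P e' (length S) \<ge> 1"
    using member_le_sum[of 0 "{..length S}" "\<lambda>i. e i C"] member_le_sum[of 0 "{..length S}" "\<lambda>i. e' i C"] pos
    by auto
  note inv_below = count_invariant_below[OF C _ _ eq _ _ cyc pos'(1) cyc pos'(2), unfolded Sbelow, OF _ _ S(2) S(2)]
  note inv_above = count_invariant_above[OF C _ _ eq _ _ cyc pos'(1) cyc pos'(2), unfolded Sabove, OF _ _ S(3) S(3)]
  note count_cyc = count_family_word_cycle[OF C S']
  \<comment> \<open>For \<open>r = 0\<close> the invariant is the number of all letters
    \<open>c\<close>, which is the sum of all exponents.\<close>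
  have total: "?P e (length S) = ?P e' (length S)"
  proof -
    have c: "hd (cycle_word C) \<in> cverts C"
      using cycle_word(3,5)[OF C] hd_in_set by metis
    from inv_below[OF c, of 0] show ?thesis using count_cyc[OF order_refl c] by simp
  qed
  have here: "?P e k = ?P e' k" if k: "k < length S" and adj: "S ! k \<in> adj_set V E C" for k
  proof -
    let ?z = "S ! k"
    obtain post post' where post: "?w = family_word S e k @ ?z # post" "?w' = family_word S e' k @ ?z # post'"
      using family_word_split[OF k] by metis
    have zc: "?z \<notin> cycle_vertices V E" using S' k by (meson disjoint_iff nth_mem)
    then have zC: "c \<noteq> ?z" if "c \<in> cverts C" for c using that C by (auto simp: cycle_vertices_def)
    have pre_z: "count_list (family_word S e k) ?z = count_list (family_word S e' k) ?z"
      using count_non[of k ?z] zc k by simp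
    have "count_list ?w ?z = count_list ?w' ?z" using count_non[of "length S" ?z] zc by simp
    then have post_z: "count_list post ?z = count_list post' ?z" using pre_z unfolding post by simp
    have sum: "count_list (family_word S e k) c + count_list post c = ?P e (length S)"
      "count_list (family_word S e' k) c + count_list post' c = ?P e' (length S)" if c: "c \<in> cverts C" for c
      using count_cyc[OF order_refl c, of e] count_cyc[OF order_refl c, of e'] zC[OF c]
      unfolding post by simp_all
    show ?thesis
      using C adj
    proof (cases rule: adj_set_cases)
      case (below c)
      \<comment> \<open>This \<open>r\<close> singles out the occurrence of \<open>?z\<close> at
        position \<open>k\<close>; the skeleton being common, it is the same for both words.\<close>
      note inv = inv_below[OF below(2), of "Suc (count_list (family_word S e k) ?z)" ?z]
      have "count_list post c = count_list post' c"
        using inv below(1,3) occ_after_split[OF zC[OF below(2)]] unfolding post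
        by (metis pre_z)
      then show ?thesis using sum[OF below(2)] total count_cyc[OF _ below(2), of k] k by simp
    next
      case (above c)
      \<comment> \<open>In the reversed word exactly the letters \<open>?z\<close> of
        \<open>post\<close> come before the occurrence at position \<open>k\<close>.\<close>
      note inv = inv_above[OF above(2), of ?z "Suc (count_list (rev post) ?z)"]
      have "count_list (rev (family_word S e k)) c = count_list (rev (family_word S e' k)) c"
        using inv above(1,3) occ_after_split[OF zC[OF above(2)], of "rev post"]
          occ_after_split[OF zC[OF above(2)], of "rev post'"] post_z
        unfolding post by simp
      then show ?thesis using count_cyc[OF _ above(2), of k] k by simp
    qed
  qed
  \<comment> \<open>Downwards from the total: behind a letter that is no neighbour of
    \<open>C\<close> the exponent vanishes, so the partial sum does not change.\<close>
  have all: "?P e k = ?P e' k" if "k \<le> length S" for k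
    using that
  proof (induction rule: inc_induct)
    case (step k)
    show ?case
    proof (cases "S ! k \<in> adj_set V E C")
      case False
      then show ?thesis using step supp[OF step(2)] by simp
    qed (rule here[OF step(2)])
  qed (rule total)
  show ?thesis
  proof (cases i)
    case 0
    then show ?thesis using all[of 0] by simp
  next
    case (Suc j)
    then show ?thesis using all[of j] all[of i] i by simp
  qed
qed

lemma finite_hk_ball: "finite (hk_ball n)"
  unfolding hk_ball_def using finite_lists_length_le[OF finite_V] by (rule finite_imageI)

lemma hk_class_eqD:
  assumes "hk_class V E u = hk_class V E w" "set u \<subseteq> V"
  shows "hk_eq V E u w"
proof -
  have "u \<in> hk_class V E u" using assms(2) by (simp add: hk_class_def)
  then show ?thesis unfolding assms(1) by (simp add: hk_class_def)
qed

lemma card_hk_ball_ge: "\<exists>c>0. \<forall>n\<ge>1. n ^ hk_degree \<le> card (hk_ball (c * n))"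
proof -
  obtain S where S: "set S \<subseteq> below \<union> above" "tight E (filter (\<lambda>x. x \<in> below) S)"
    "tight (\<lambda>a b. E b a) (filter (\<lambda>x. x \<in> above) (rev S))"
    "\<And>C. C \<in> cycles V E \<Longrightarrow> length (filter (\<lambda>x. x \<in> adj_set V E C) S) = degree_bound C"
    using skeleton_exists by metis
  \<comment> \<open>The slots where \<open>C\<close> receives a free exponent: one before the
    skeleton and one behind each neighbour of \<open>C\<close>, that is
    \<open>degree_bound C + 1\<close> in all.\<close>
  define J where "J C = insert 0 (Suc ` {k. k < length S \<and> S ! k \<in> adj_set V E C})" for C
  define I where "I = Sigma (cycles V E) J"
  have finJ: "finite (J C)" for C by (simp add: J_def)
  have cardI: "card I = hk_degree"
  proof -
    have "card (J C) = degree_bound C + 1" if "C \<in> cycles V E" for C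
    proof -
      have "card (J C) = Suc (card {k. k < length S \<and> S ! k \<in> adj_set V E C})"
        unfolding J_def by (subst card_insert_disjoint) (auto simp: card_image)
      then show ?thesis using S(4)[OF that] by (simp add: length_filter_conv_card)
    qed
    then show ?thesis
      unfolding I_def hk_degree_def using finJ finite_cycles(1) by (subst card_SigmaI) auto
  qed
  define ex where "ex f i C = (if (C, i) \<in> I then f (C, i) else (0::nat))" for f i C
  define W where "W f = family_word S (ex f) (length S)" for f
  \<comment> \<open>There are \<open>length S\<close> skeleton letters and
    \<open>Suc (length S)\<close> blocks, each of length at most \<open>n\<close> times the number
    of cycles times \<open>card V\<close>; the outer \<open>Suc\<close> makes \<open>c\<close>
    positive.\<close>
  define c where "c = Suc (length S + Suc (length S) * (length cycle_enum * card V))"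
  have "n ^ hk_degree \<le> card (hk_ball (c * n))" if n: "n \<ge> 1" for n
  proof -
    define Fam where "Fam = PiE I (\<lambda>_. {1..n})"
    have WV: "set (W f) \<subseteq> V" for f
    proof -
      have "cycle_vertices V E \<subseteq> V" using cverts_subset by (auto simp: cycle_vertices_def)
      then have "set (block e) \<subseteq> V" for e using set_block by blast
      moreover have "S ! k \<in> V" if "k < length S" for k
        using that S(1) below_above(2) nth_mem by blast
      ultimately have "set (family_word S e k) \<subseteq> V" if "k \<le> length S" for e k
        using that by (induction k) (auto simp: Suc_le_eq)
      then show ?thesis by (simp add: W_def)
    qed
    have len: "length (W f) \<le> c * n" if f: "f \<in> Fam" for f
    proof -
      have ex: "ex f i C \<le> n" for i C
        using f n by (auto simp: ex_def Fam_def PiE_def Pi_def)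
      have block: "length (block (ex f i)) \<le> length cycle_enum * card V * n" for i
      proof -
        have "length (cycle_word C) \<le> card V" if "C \<in> set cycle_enum" for C
          using cycle_word(3,4)[of C] cycle_enum(1) that card_mono[OF finite_V cverts_subset, of C]
          by (metis distinct_card)
        then have "length (concat (replicate (ex f i C) (cycle_word C))) \<le> n * card V"
          if "C \<in> set cycle_enum" for C
          unfolding length_concat_replicate using ex that by (intro mult_le_mono) auto
        then have "sum_list (map (\<lambda>C. length (concat (replicate (ex f i C) (cycle_word C)))) cycle_enum)
            \<le> sum_list (map (\<lambda>C. n * card V) cycle_enum)"
          by (intro sum_list_mono)
        then show ?thesis
          by (simp add: block_def length_concat o_def sum_list_triv mult.commute mult.left_commute)
      qed
      have "length (family_word S (ex f) k) \<le> k + Suc k * (length cycle_enum * card V * n)" for k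
      proof (induction k)
        case (Suc k)
        then show ?case using block[of "Suc k"] by simp
      qed (use block[of 0] in simp)
      from this[of "length S"]
      have "length (W f) \<le> length S * 1 + Suc (length S) * (length cycle_enum * card V) * n"
        by (simp only: W_def mult_1_right mult.assoc)
      also have "\<dots> \<le> length S * n + Suc (length S) * (length cycle_enum * card V) * n"
        using n by (intro add_mono mult_le_mono) auto
      also have "\<dots> \<le> c * n" by (simp add: c_def algebra_simps)
      finally show ?thesis .
    qed
    have inj: "inj_on (\<lambda>f. hk_class V E (W f)) Fam"
    proof (rule inj_onI)
      fix f g assume fg: "f \<in> Fam" "g \<in> Fam" "hk_class V E (W f) = hk_class V E (W g)"
      have eq: "hk_eq V E (W f) (W g)" using hk_class_eqD[OF fg(3) WV] .
      show "f = g"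
      proof (rule PiE_ext[where k = I and s = "\<lambda>_. {1..n}"])
        show "f \<in> PiE I (\<lambda>_. {1..n})" "g \<in> PiE I (\<lambda>_. {1..n})" using fg by (auto simp: Fam_def)
        fix x assume x: "x \<in> I"
        obtain C i where Ci: "x = (C, i)" "C \<in> cycles V E" "i \<in> J C" using x by (auto simp: I_def)
        have z: "(C, 0) \<in> I" using Ci by (auto simp: I_def J_def)
        have "ex f i C = ex g i C"
        proof (rule family_word_inj[where e = "ex f" and e' = "ex g", OF S(1-3) Ci(2)])
          show "ex f 0 C \<ge> 1" "ex g 0 C \<ge> 1" using z fg by (auto simp: ex_def Fam_def)
          show "hk_eq V E (family_word S (ex f) (length S)) (family_word S (ex g) (length S))"
            using eq by (simp add: W_def)
          show "i \<le> length S" using Ci(3) by (auto simp: J_def)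
          show "ex f (Suc k) C = 0 \<and> ex g (Suc k) C = 0" if "S ! k \<notin> adj_set V E C" for k
            using that by (auto simp: ex_def I_def J_def)
        qed
        then show "f x = g x" using x Ci by (simp add: ex_def)
      qed
    qed
    have "(\<lambda>f. hk_class V E (W f)) ` Fam \<subseteq> hk_ball (c * n)"
      using WV len by (auto simp: hk_ball_def)
    then have "card Fam \<le> card (hk_ball (c * n))"
      using card_inj_on_le[OF inj _ finite_hk_ball] by blast
    moreover have "card Fam = n ^ hk_degree"
    proof -
      have "finite I" unfolding I_def using finite_cycles(1) finJ by auto
      then show ?thesis unfolding Fam_def cardI[symmetric] by (simp add: card_PiE)
    qed
    ultimately show ?thesis by simp
  qed
  then show ?thesis by (intro exI[of _ c]) (auto simp: c_def)
qed

end

section \<open>The Gelfand--Kirillov dimension\<close>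

interpretation fun_space: vector_space "fscale :: 'k::field \<Rightarrow> ('a \<Rightarrow> 'k) \<Rightarrow> 'a \<Rightarrow> 'k"
  by unfold_locales (auto simp: fun_eq_iff algebra_simps)

section \<open>Supports and dimensions in a space of functions\<close>

definition point :: "'a \<Rightarrow> 'a \<Rightarrow> 'k::field" where
  "point a = (\<lambda>x. if x = a then 1 else 0)"

definition supported :: "'a set \<Rightarrow> ('a \<Rightarrow> 'k::field) set" where
  "supported S = {f. \<forall>x. f x \<noteq> 0 \<longrightarrow> x \<in> S}"

lemma supported_mono: "S \<subseteq> T \<Longrightarrow> supported S \<subseteq> supported T"
  by (auto simp: supported_def)

lemma span_subset_supported:
  assumes "A \<subseteq> (supported S :: ('a \<Rightarrow> 'k::field) set)"
  shows "fspan A \<subseteq> supported S"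
proof (rule fun_space.span_minimal[OF assms])
  show "fun_space.subspace (supported S :: ('a \<Rightarrow> 'k) set)"
    by (rule fun_space.subspaceI) (auto simp: supported_def, force)
qed

lemma sum_fun_apply: "(\<Sum>a\<in>A. f a) x = (\<Sum>a\<in>A. f a x)"
  by (induction A rule: infinite_finite_induct) auto

lemma supported_subset_span:
  assumes "finite S"
  shows "(supported S :: ('a \<Rightarrow> 'k::field) set) \<subseteq> fspan (point ` S)"
proof
  fix f :: "'a \<Rightarrow> 'k" assume f: "f \<in> supported S"
  have "f = (\<Sum>a\<in>S. fscale (f a) (point a))"
  proof
    fix x
    have "(\<Sum>a\<in>S. fscale (f a) (point a)) x = (\<Sum>a\<in>S. if a = x then f a else 0)"
      unfolding sum_fun_apply by (rule sum.cong) (auto simp: point_def)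
    then show "f x = (\<Sum>a\<in>S. fscale (f a) (point a)) x"
      using f assms by (auto simp: supported_def)
  qed
  also have "\<dots> \<in> fspan (point ` S)"
    by (intro fun_space.span_sum fun_space.span_scale fun_space.span_base) auto
  finally show "f \<in> fspan (point ` S)" .
qed

lemma inj_point: "inj (point :: 'a \<Rightarrow> 'a \<Rightarrow> 'k::field)"
  by (rule injI) (metis point_def zero_neq_one)

lemma independent_points:
  assumes "finite S"
  shows "fun_space.independent (point ` S :: ('a \<Rightarrow> 'k::field) set)"
proof (rule fun_space.independent_if_scalars_zero)
  show "finite (point ` S :: ('a \<Rightarrow> 'k) set)" using assms by simp
  fix g :: "('a \<Rightarrow> 'k) \<Rightarrow> 'k" and x :: "'a \<Rightarrow> 'k"
  assume z: "(\<Sum>x\<in>point ` S. fscale (g x) x) = 0" and "x \<in> point ` S"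
  then obtain a where a: "a \<in> S" "x = point a" by auto
  have "0 = (\<Sum>x\<in>point ` S. fscale (g x) x) a" using z by simp
  also have "\<dots> = (\<Sum>b\<in>S. fscale (g (point b)) (point b)) a"
    by (subst sum.reindex) (auto intro: inj_on_subset[OF inj_point])
  also have "\<dots> = (\<Sum>b\<in>S. if b = a then g (point b) else 0)"
    unfolding sum_fun_apply by (rule sum.cong) (auto simp: point_def)
  also have "\<dots> = g x" using a assms by simp
  finally show "g x = 0" by simp
qed

lemma dim_le_card_support:
  assumes "W \<subseteq> (supported S :: ('a \<Rightarrow> 'k::field) set)" "finite S"
  shows "fdim W \<le> card S"
proof -
  have "W \<subseteq> fspan (point ` S)" using assms supported_subset_span by blast
  then have "fdim W \<le> card (point ` S :: ('a \<Rightarrow> 'k) set)"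
    by (rule fun_space.dim_le_card) (use assms in simp)
  then show ?thesis using card_image_le[OF assms(2)] le_trans by blast
qed

text \<open>The finite support forces a basis of \<open>W\<close> to be finite; for an infinite
  basis \<open>fdim\<close> would be 0.\<close>

lemma card_le_dim:
  assumes "W \<subseteq> (supported T :: ('a \<Rightarrow> 'k::field) set)" "finite T" "point ` S \<subseteq> W" "finite S"
  shows "card S \<le> fdim W"
proof -
  obtain B where B: "B \<subseteq> W" "fun_space.independent B" "W \<subseteq> fspan B" "card B = fdim W"
    using fun_space.basis_exists .
  have "B \<subseteq> fspan (point ` T)" using B(1) assms(1) supported_subset_span[OF assms(2)] by blast
  then have "finite B"
    using fun_space.independent_span_bound[OF _ B(2)] assms(2) by blast
  have "card S = card (point ` S :: ('a \<Rightarrow> 'k) set)"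
    using card_image[OF inj_on_subset[OF inj_point subset_UNIV]] by metis
  also have "\<dots> \<le> card B"
    using fun_space.independent_span_bound[OF \<open>finite B\<close> independent_points[OF assms(4)]]
      assms(3) B(3) by blast
  finally show ?thesis using B(4) by simp
qed

text \<open>The shape fits both estimates: the upper one with \<open>b = 1\<close>, the lower one
  with \<open>b = 0\<close> and \<open>c = 0\<close>.\<close>

lemma tendsto_ln_ratio:
  fixes a b c :: real
  assumes "a > 0" "b \<ge> 0"
  shows "(\<lambda>n. (c + real d * ln (a * real n + b)) / ln (real n)) \<longlonglongrightarrow> real d"
proof -
  have 1: "(\<lambda>n. c / ln (real n)) \<longlonglongrightarrow> 0" by real_asymp
  have 2: "(\<lambda>n. ln (a * real n + b) / ln (real n)) \<longlonglongrightarrow> 1" using assms by real_asymp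
  have "(\<lambda>n. c / ln (real n) + real d * (ln (a * real n + b) / ln (real n))) \<longlonglongrightarrow> 0 + real d * 1"
    by (intro tendsto_intros 1 2)
  then show ?thesis by (simp add: add_divide_distrib)
qed

context separated_cycles
begin

section \<open>Filtrations of the algebra and balls of the monoid\<close>

lemma hk_ball_mono: "m \<le> n \<Longrightarrow> hk_ball m \<subseteq> hk_ball n"
  by (auto simp: hk_ball_def)

lemma hk_elems_eq_Union_hk_ball: "hk_elems V E = (\<Union>n. hk_ball n)"
  by (auto simp: hk_elems_def hk_ball_def)

lemma hk_mul_class:
  assumes "set u \<subseteq> V" "set w \<subseteq> V"
  shows "hk_mul V E (hk_class V E u) (hk_class V E w) = hk_class V E (u @ w)"
proof -
  have rep: "hk_eq V E (SOME x. x \<in> hk_class V E u) u" if "set u \<subseteq> V" for u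
  proof -
    have "u \<in> hk_class V E u" using that by (simp add: hk_class_def)
    then have "(SOME x. x \<in> hk_class V E u) \<in> hk_class V E u" by (rule someI)
    then show ?thesis by (simp add: hk_class_def)
  qed
  show ?thesis
    unfolding hk_mul_def by (rule hk_class_eq) (intro hk_eq_append rep assms)
qed

lemma hk_mul_hk_ball: "a \<in> hk_ball m \<Longrightarrow> b \<in> hk_ball n \<Longrightarrow> hk_mul V E a b \<in> hk_ball (m + n)"
  by (auto simp: hk_ball_def hk_mul_class)

lemma alg_mult_supported:
  assumes "f \<in> supported (hk_ball m)" "g \<in> supported (hk_ball n)"
  shows "alg_mult V E f g \<in> supported (hk_ball (m + n))"
  unfolding supported_def
proof (intro CollectI allI impI)
  fix c assume "alg_mult V E f g c \<noteq> 0"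
  then obtain p where "p \<in> {(a, b). f a \<noteq> 0 \<and> g b \<noteq> 0 \<and> hk_mul V E a b = c}"
    unfolding alg_mult_def by (rule sum.not_neutral_contains_not_neutral)
  then show "c \<in> hk_ball (m + n)"
    using assms hk_mul_hk_ball by (auto simp: supported_def)
qed

lemma sub_pow_supported:
  assumes "W \<subseteq> supported (hk_ball m)"
  shows "sub_pow V E W i \<subseteq> supported (hk_ball (m * i))"
proof (induction i)
  case 0
  show ?case
    by (simp, rule span_subset_supported) (auto simp: alg_one_def supported_def hk_ball_def)
next
  case (Suc i)
  have "alg_mult V E f g \<in> supported (hk_ball (m * Suc i))" if "f \<in> sub_pow V E W i" "g \<in> W" for f g
    using alg_mult_supported[of f "m * i" g m] Suc assms that by (auto simp: add.commute)
  then show ?case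
    by (simp only: sub_pow.simps sub_mult_def) (rule span_subset_supported, blast)
qed

lemma sub_filt_supported:
  assumes "W \<subseteq> supported (hk_ball m)"
  shows "sub_filt V E W n \<subseteq> supported (hk_ball (m * n))"
  unfolding sub_filt_def
proof (rule span_subset_supported, rule UN_least)
  fix i assume "i \<in> {..n}"
  then have "hk_ball (m * i) \<subseteq> hk_ball (m * n)" by (intro hk_ball_mono) simp
  with sub_pow_supported[OF assms, of i] supported_mono
  show "sub_pow V E W i \<subseteq> supported (hk_ball (m * n))" by blast
qed

text \<open>Finitely many elements involve finitely many classes; the sum of their radii bounds each
  of them, and \<open>Suc\<close> makes it positive.\<close>

lemma finite_subset_supported:
  fixes B :: "('v list set \<Rightarrow> 'k::field) set"
  assumes "finite B" "B \<subseteq> hk_algebra V E"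
  obtains m where "m \<ge> 1" "B \<subseteq> supported (hk_ball m)"
proof -
  define T where "T = (\<Union>f\<in>B. {c. f c \<noteq> 0})"
  have T: "finite T" "T \<subseteq> hk_elems V E" using assms by (auto simp: T_def hk_algebra_def)
  then obtain h where h: "\<And>c. c \<in> T \<Longrightarrow> c \<in> hk_ball (h c)"
    unfolding hk_elems_eq_Union_hk_ball by (metis UN_E subsetD)
  have "c \<in> hk_ball (Suc (\<Sum>c\<in>T. h c))" if "c \<in> T" for c
    using h[OF that] hk_ball_mono[of "h c" "Suc (\<Sum>c\<in>T. h c)"] member_le_sum[OF that, of h] T(1)
    by auto
  then have "B \<subseteq> supported (hk_ball (Suc (\<Sum>c\<in>T. h c)))" by (auto simp: supported_def T_def)
  then show thesis by (rule that[rotated]) simp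
qed

definition gen_points :: "('v list set \<Rightarrow> 'k::field) set" where
  "gen_points = (\<lambda>v. point (hk_class V E [v])) ` V"

lemma gen_points: "finite (gen_points :: ('v list set \<Rightarrow> 'a::field) set)"
  "(gen_points :: ('v list set \<Rightarrow> 'a) set) \<subseteq> hk_algebra V E"
  "(gen_points :: ('v list set \<Rightarrow> 'a) set) \<subseteq> supported (hk_ball 1)"
proof -
  show "finite (gen_points :: ('v list set \<Rightarrow> 'a) set)" using finite_V by (simp add: gen_points_def)
  show "(gen_points :: ('v list set \<Rightarrow> 'a) set) \<subseteq> supported (hk_ball 1)"
    by (auto simp: gen_points_def supported_def point_def hk_ball_def intro!: imageI split: if_splits)
  show "(gen_points :: ('v list set \<Rightarrow> 'a) set) \<subseteq> hk_algebra V E"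
  proof
    fix f :: "'v list set \<Rightarrow> 'a" assume "f \<in> gen_points"
    then obtain v where v: "f = point (hk_class V E [v])" "v \<in> V" by (auto simp: gen_points_def)
    then have "{c. f c \<noteq> 0} = {hk_class V E [v]}" by (auto simp: point_def)
    moreover have "hk_class V E [v] \<in> hk_elems V E"
      unfolding hk_elems_def using v(2) by (intro CollectI exI[of _ "[v]"]) simp
    ultimately show "f \<in> hk_algebra V E" by (simp add: hk_algebra_def)
  qed
qed

lemma alg_mult_point:
  "alg_mult V E (point a) (point b) = (point (hk_mul V E a b) :: 'v list set \<Rightarrow> 'k::field)"
proof
  fix c
  have "{(x, y). point a x \<noteq> (0::'k) \<and> point b y \<noteq> (0::'k) \<and> hk_mul V E x y = c}
      = (if hk_mul V E a b = c then {(a, b)} else {})"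
    by (auto simp: point_def split: if_splits)
  then show "alg_mult V E (point a) (point b) c = (point (hk_mul V E a b) c :: 'k)"
    unfolding alg_mult_def by (simp add: point_def)
qed

lemma point_in_sub_pow:
  assumes "set w \<subseteq> V"
  shows "(point (hk_class V E w) :: 'v list set \<Rightarrow> 'k::field) \<in> sub_pow V E (fspan gen_points) (length w)"
  using assms
proof (induction w rule: rev_induct)
  case Nil
  have "alg_one V E = (point (hk_class V E []) :: 'v list set \<Rightarrow> 'k)" by (auto simp: alg_one_def point_def)
  then show ?case by (simp add: fun_space.span_base)
next
  case (snoc v w)
  have "(point (hk_class V E (w @ [v])) :: 'v list set \<Rightarrow> 'k) = alg_mult V E (point (hk_class V E w)) (point (hk_class V E [v]))"
    using snoc.prems by (simp add: alg_mult_point hk_mul_class)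
  moreover have "(point (hk_class V E [v]) :: 'v list set \<Rightarrow> 'k) \<in> fspan gen_points"
    using snoc.prems by (intro fun_space.span_base) (auto simp: gen_points_def)
  ultimately show ?case
    using snoc by (auto simp: sub_mult_def intro!: fun_space.span_base)
qed

lemma points_subset_sub_filt: "point ` hk_ball n \<subseteq> sub_filt V E (fspan gen_points) n"
proof
  fix f assume "f \<in> point ` hk_ball n"
  then obtain w where w: "f = point (hk_class V E w)" "set w \<subseteq> V" "length w \<le> n"
    by (auto simp: hk_ball_def)
  with point_in_sub_pow[OF w(2)] show "f \<in> sub_filt V E (fspan gen_points) n"
    unfolding sub_filt_def by (intro fun_space.span_base) auto
qed

text \<open>Generators supported in \<open>hk_ball m\<close> only stretch the radius by the factor
  \<open>m\<close>, which the limit does not notice. The supremum is attained at the letters, whose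
  filtration contains the points of the whole ball.\<close>

lemma GKdim_HK_eq: "GKdim_HK TYPE('k::field) V E = ereal (real hk_degree)"
proof (rule antisym)
  let ?g = "\<lambda>B n. ereal (ln (real (fdim (sub_filt V E (fspan B) n))) / ln (real n))"
  show "GKdim_HK TYPE('k) V E \<le> ereal (real hk_degree)"
    unfolding GKdim_HK_def
  proof (rule SUP_least)
    fix B :: "('v list set \<Rightarrow> 'k) set"
    assume B: "B \<in> {B. finite B \<and> B \<subseteq> hk_algebra V E}"
    obtain m where m: "m \<ge> 1" "B \<subseteq> supported (hk_ball m)"
      using finite_subset_supported[of B] B by auto
    obtain c where c: "\<And>n. card (hk_ball n) \<le> c * (n + 1) ^ hk_degree"
      using card_hk_ball_le by blast
    \<comment> \<open>The successor makes \<open>ln c'\<close> nonnegative, which covers dimension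
      0, where the left side is \<open>ln 0 = 0\<close>.\<close>
    define c' where "c' = real (Suc c)"
    have ub: "ln (real (fdim (sub_filt V E (fspan B) n)))
        \<le> ln c' + real hk_degree * ln (real m * real n + 1)" for n
    proof -
      let ?d = "fdim (sub_filt V E (fspan B) n)"
      have "?d \<le> card (hk_ball (m * n))"
        using dim_le_card_support[OF sub_filt_supported[OF span_subset_supported[OF m(2)]] finite_hk_ball] .
      also have "\<dots> \<le> c * (m * n + 1) ^ hk_degree" by (rule c)
      also have "\<dots> \<le> Suc c * (m * n + 1) ^ hk_degree" by simp
      finally have "real ?d \<le> real (Suc c * (m * n + 1) ^ hk_degree)" by (rule of_nat_mono)
      then have d: "real ?d \<le> c' * (real m * real n + 1) ^ hk_degree"
        by (simp only: c'_def of_nat_mult of_nat_power of_nat_add of_nat_1)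
      have pos: "0 < c'" "1 \<le> c'" "1 \<le> real m * real n + 1" by (auto simp: c'_def)
      have eq: "ln (c' * (real m * real n + 1) ^ hk_degree) = ln c' + real hk_degree * ln (real m * real n + 1)"
      proof -
        have "ln (c' * y ^ hk_degree) = ln c' + real hk_degree * ln y" if "y \<ge> 1" for y
          using pos(1) that by (simp add: ln_mult ln_realpow)
        then show ?thesis using pos(3) .
      qed
      show ?thesis
      proof (cases "?d = 0")
        case True
        then show ?thesis using pos by simp
      next
        case False
        then have "ln (real ?d) \<le> ln (c' * (real m * real n + 1) ^ hk_degree)"
          using d by (subst ln_le_cancel_iff) auto
        then show ?thesis by (simp only: eq)
      qed
    qed
    have "limsup (?g B) \<le> limsup (\<lambda>n. ereal ((ln c' + real hk_degree * ln (real m * real n + 1)) / ln (real n)))"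
      by (rule Limsup_mono, rule eventually_mono[OF eventually_ge_at_top[of 1]])
        (use ub in \<open>auto intro!: divide_right_mono\<close>)
    also have "\<dots> = ereal (real hk_degree)"
      using tendsto_ln_ratio[of "real m" 1 "ln c'" hk_degree] m(1)
      by (intro lim_imp_Limsup) auto
    finally show "limsup (?g B) \<le> ereal (real hk_degree)" .
  qed
  show "ereal (real hk_degree) \<le> GKdim_HK TYPE('k) V E"
  proof -
    let ?B = "gen_points :: ('v list set \<Rightarrow> 'k) set"
    obtain c where c: "c > 0" "\<And>n. n \<ge> 1 \<Longrightarrow> n ^ hk_degree \<le> card (hk_ball (c * n))"
      using card_hk_ball_ge by blast
    \<comment> \<open>The family is taken with exponents up to \<open>n div c\<close>, so that its
      words have length at most \<open>n\<close>. Rounding costs at most a factor 2, hence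
      \<open>2 * real c\<close>. The zero summands match \<open>tendsto_ln_ratio\<close>.\<close>
    have lb: "(0 + real hk_degree * ln (1 / (2 * real c) * real n + 0)) / ln (real n)
        \<le> ln (real (fdim (sub_filt V E (fspan ?B) n))) / ln (real n)" if n: "n \<ge> 2 * c" for n
    proof -
      let ?d = "fdim (sub_filt V E (fspan ?B) n)" and ?k = "n div c"
      have "2 \<le> ?k" using n c(1) by (simp add: less_eq_div_iff_mult_less_eq)
      then have k1: "?k \<ge> 1" by simp
      have "real n = real c * real ?k + real (n mod c)" by (metis div_mult_mod_eq mult.commute of_nat_add of_nat_mult)
      also have "\<dots> \<le> real c * real ?k + real c * real ?k"
      proof -
        have "n mod c \<le> c * 1" using mod_less_divisor[OF c(1), of n] by simp
        also have "\<dots> \<le> c * ?k" using k1 by (rule mult_le_mono2)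
        finally have "n mod c \<le> c * ?k" .
        then have "real (n mod c) \<le> real (c * ?k)" by (rule of_nat_mono)
        then show ?thesis by simp
      qed
      finally have "1 / (2 * real c) * real n \<le> real ?k" using c(1) by (simp add: field_simps)
      moreover have pos: "0 < 1 / (2 * real c) * real n" using n c(1) by simp
      ultimately have lnk: "ln (1 / (2 * real c) * real n) \<le> ln (real ?k)"
        by (subst ln_le_cancel_iff) auto
      have "?k ^ hk_degree \<le> card (hk_ball (c * ?k))" by (rule c(2)[OF k1])
      also have "\<dots> \<le> card (hk_ball n)"
        by (intro card_mono finite_hk_ball hk_ball_mono) simp
      also have "\<dots> \<le> ?d"
        by (rule card_le_dim[OF sub_filt_supported[OF span_subset_supported[OF gen_points(3)]]
              finite_hk_ball points_subset_sub_filt finite_hk_ball])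
      finally have "real ?k ^ hk_degree \<le> real ?d" by (metis of_nat_mono of_nat_power)
      then have "ln (real ?k ^ hk_degree) \<le> ln (real ?d)"
        using k1 by (intro ln_mono) auto
      then have "real hk_degree * ln (real ?k) \<le> ln (real ?d)"
        using k1 by (simp add: ln_realpow)
      then have "real hk_degree * ln (1 / (2 * real c) * real n) \<le> ln (real ?d)"
        using mult_left_mono[OF lnk, of "real hk_degree"] by simp
      then show ?thesis using n c(1) by (intro divide_right_mono) auto
    qed
    have "ereal (real hk_degree)
        = limsup (\<lambda>n. ereal ((0 + real hk_degree * ln (1 / (2 * real c) * real n + 0)) / ln (real n)))"
      using tendsto_ln_ratio[of "1 / (2 * real c)" 0 0 hk_degree] c(1)
      by (intro lim_imp_Limsup[symmetric]) auto
    also have "\<dots> \<le> limsup (?g ?B)"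
      by (rule Limsup_mono, rule eventually_mono[OF eventually_ge_at_top[of "2 * c"]])
        (use lb in \<open>simp only: ereal_less_eq\<close>)
    also have "\<dots> \<le> GKdim_HK TYPE('k) V E"
      unfolding GKdim_HK_def by (rule SUP_upper) (use gen_points in auto)
    finally show ?thesis .
  qed
qed

end

theorem theorem3p6:
  fixes V :: "'v set" and E :: "'v \<Rightarrow> 'v \<Rightarrow> bool"
  assumes graph: "simple_oriented_graph V E"
    and no_conn: "\<forall>C1 \<in> cycles V E. \<forall>C2 \<in> cycles V E. C1 \<noteq> C2 \<longrightarrow>
                    \<not> (\<exists>p. opath V E p \<and> hd p \<in> cverts C1 \<and> last p \<in> cverts C2)"
  shows "(\<forall>x \<in> V. x \<notin> cycle_vertices V E \<and>
            (\<exists>p. path_between V E (cycle_vertices V E) x p) \<longrightarrow>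
            (\<forall>p. path_between V E (cycle_vertices V E) x p \<longrightarrow> hd p = x) \<or>
            (\<forall>p. path_between V E (cycle_vertices V E) x p \<longrightarrow> hd p \<in> cycle_vertices V E))
       \<and> GKdim_HK TYPE('k::field) V E =
           ereal (real (\<Sum>C \<in> cycles V E. (\<Sum>x \<in> adj_set V E C. kx V E C x) + 1))
       \<and> (cycles V E = {} \<longrightarrow> GKdim_HK TYPE('k::field) V E = 0)"
proof -
  interpret separated_cycles V E using graph no_conn by unfold_locales
  \<comment> \<open>Without cycles the sum is empty, which gives the last conjunct.\<close>
  show ?thesis
    using paths_one_sided by (simp add: GKdim_HK_eq hk_degree_def degree_bound_def)
qed

end
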